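(* Let $G$ be a finite group with character table $\chi=(\chi_i(g_j))_{0\le i,j\le n}$, let $R$ be a faithful finite-dimensional complex representation of $G$, and let $R_X=\sum_{x\in X}xR_x$ be a formal sum of finite-dimensional representations of $G$. Then for all $1\le k\le n+1$ and all $0\le i_1<\dots<i_k\le n$, $0\le j_1<\dots<j_k\le n$: $$M[R_X]^{i_1,\dots ,i_k}_{j_1,\dots ,j_k}=\frac{1}{|G|^k}\sum_{0\le p_1<\dots <p_k\le n}\chi^{i_1,\dots ,i_k}_{p_1,\dots ,p_k}\,\overline{\chi^{j_1,\dots ,j_k}_{p_1,\dots ,p_k}}\prod_{m=1}^k|C_{p_m}|\,\chi^{R_X}(g_{p_m}),$$ $$M[R_A(q)]^{i_1,\dots ,i_k}_{j_1,\dots ,j_k}=\frac{1}{|G|^k}\sum_{0\le p_1<\dots <p_k\le n}\chi^{i_1,\dots ,i_k}_{p_1,\dots ,p_k}\,\overline{\chi^{j_1,\dots ,j_k}_{p_1,\dots ,p_k}}\prod_{m=1}^k|C_{p_m}|\det (E+qR(g_{p_m})),$$ $$M[R_S(q)]^{i_1,\dots ,i_k}_{j_1,\dots ,j_k}=\frac{1}{|G|^k}\sum_{0\le p_1<\dots <p_k\le n}\chi^{i_1,\dots ,i_k}_{p_1,\dots ,p_k}\,\overline{\chi^{j_1,\dots ,j_k}_{p_1,\dots ,p_k}}\prod_{m=1}^k\frac{|C_{p_m}|}{\det (E-qR(g_{p_m}))},$$ $$M[R_T(q)]^{i_1,\dots ,i_k}_{j_1,\dots ,j_k}=\frac{1}{|G|^k}\sum_{0\le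 p_1<\dots <p_k\le n}\chi^{i_1,\dots ,i_k}_{p_1,\dots ,p_k}\,\overline{\chi^{j_1,\dots ,j_k}_{p_1,\dots ,p_k}}\prod_{m=1}^k\frac{|C_{p_m}|}{1-q\,\mathrm{tr}\,R(g_{p_m})},$$ $$M[R_P(q)]^{i_1,\dots ,i_k}_{j_1,\dots ,j_k}=\frac{1}{|G|^k}\sum_{0\le p_1<\dots <p_k\le n}\chi^{i_1,\dots ,i_k}_{p_1,\dots ,p_k}\,\overline{\chi^{j_1,\dots ,j_k}_{p_1,\dots ,p_k}}\prod_{m=1}^k|C_{p_m}|\,\mathrm{tr}\,(E-qR(g_{p_m}))^{-1}.$$
   Context: $R_0$ (trivial), $R_1,\dots,R_n$ are the irreducible complex representations of the finite group $G$ up to isomorphism, with characters $\chi_0,\dots,\chi_n$; $C_0,\dots,C_n$ are the conjugacy classes of $G$, $g_j\in C_j$ is a representative, $g_0$ is the identity. The scalar product of representations is $(R,Q)=\frac1{|G|}\sum_{g\in G}\chi^R(g)\overline{\chi^Q(g)}$, where $\chi^R$ is the character of $R$. For a matrix $N$ with rows and columns indexed by $0,\dots,n$, $N^{i_1,\dots,i_k}_{j_1,\dots,j_k}$ denotes the minor (determinant of the submatrix) formed by rows $i_1,\dots,i_k$ and columns $j_1,\dots,j_k$; $N^i_j$ is the entry in row $i$ and column $j$. $E$ is the identity matrix. $R_X=\sum_{x\in X}xR_x$ is a formal sum of finite-dimensional representations $R_x$ over a set $X$ of commuting variables; its character is $\chi^{R_X}=\sum_{x\in X} x\chi^{R_x}$.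 The Clebsch–Gordan matrix $M[R_X]$ is the matrix of tensor multiplication by $R_X$ in the representation ring: $R_X\otimes R_i=\sum_{j=0}^nM[R_X]^i_jR_j$, i.e. $M[R_X]^i_j=(R_X\otimes R_i,R_j)$, $M[R_X]=\sum_{x\in X}xM[R_x]$ (extended linearly to virtual representations and to formal power series in a variable $q$ with coefficients in the representation ring; all identities are identities of formal power series). $R_S^m,R_A^m,R_T^m,R_P^m$ denote respectively the $m$-th symmetric power, exterior power, tensor power, and Adams operation applied to $R$ (so $R_P^m$ is the virtual representation with character $g\mapsto\mathrm{tr}\,R(g)^m$, in particular $R_P^0=(\dim R)R_0$). Put $R_S(q)=\sum_{m\ge0}R_S^mq^m$, and similarly $R_A(q),R_T(q),R_P(q)$. *)

theory Defs
  imports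
    Complex_Main
    "HOL-Algebra.Group"
    "HOL-Library.Multiset"
    "HOL-Computational_Algebra.Formal_Power_Series"
    "Jordan_Normal_Form.VS_Connect"
begin

section \<open>Formal power series in an arbitrary set of commuting variables\<close>

text \<open>
  Monomials in variables from the type \<open>'x\<close> are finite multisets over \<open>'x\<close>. Every monomial has
  only finitely many divisors, so no finiteness of \<open>'x\<close> is needed for the Cauchy product.
\<close>

typedef ('x, 'a) mfps = "UNIV :: ('x multiset \<Rightarrow> 'a) set"
  morphisms mcoeff Abs_mfps by simp

lemma mfps_eqI: "(\<And>m. mcoeff f m = mcoeff h m) \<Longrightarrow> f = h"
  by (metis ext mcoeff_inject)

lemma mcoeff_Abs [simp]: "mcoeff (Abs_mfps f) m = f m"
  by (simp add: Abs_mfps_inverse)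

lemma finite_submultisets: "finite {a. a \<subseteq># (m :: 'x multiset)}"
proof (induction m)
  case empty
  show ?case by simp
next
  case (add x m)
  have "{a. a \<subseteq># add_mset x m} \<subseteq> {a. a \<subseteq># m} \<union> add_mset x ` {a. a \<subseteq># m}"
  proof
    fix a assume "a \<in> {a. a \<subseteq># add_mset x m}"
    then have a: "a \<subseteq># add_mset x m" by simp
    show "a \<in> {a. a \<subseteq># m} \<union> add_mset x ` {a. a \<subseteq># m}"
    proof (cases "x \<in># a")
      case True
      then obtain b where b: "a = add_mset x b" by (metis mset_add)
      with a have "b \<subseteq># m" by simp
      with b show ?thesis by blast
    next
      case False
      have "count a y \<le> count m y" for y
        using False mset_subset_eq_count[OF a, of y]
        by (cases "y = x") (simp_all add: not_in_iff)
      then have "a \<subseteq># m" by (simp add: subseteq_mset_def)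
      then show ?thesis by blast
    qed
  qed
  then show ?case using add.IH by (meson finite_UnI finite_imageI finite_subset)
qed

instantiation mfps :: (type, comm_ring_1) comm_ring_1
begin

definition "0 = Abs_mfps (\<lambda>m. 0)"
definition "1 = Abs_mfps (\<lambda>m. if m = {#} then 1 else 0)"
definition "f + h = Abs_mfps (\<lambda>m. mcoeff f m + mcoeff h m)"
definition "- f = Abs_mfps (\<lambda>m. - mcoeff f m)"
definition "f - h = Abs_mfps (\<lambda>m. mcoeff f m - mcoeff h m)"
definition "f * h = Abs_mfps (\<lambda>m. \<Sum>a | a \<subseteq># m. mcoeff f a * mcoeff h (m - a))"

instance
proof
  fix f h k :: "('a, 'b) mfps"
  show "f + h + k = f + (h + k)"
    by (rule mfps_eqI) (simp add: plus_mfps_def ac_simps)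
  show "f + h = h + f"
    by (rule mfps_eqI) (simp add: plus_mfps_def ac_simps)
  show "0 + f = f"
    by (rule mfps_eqI) (simp add: plus_mfps_def zero_mfps_def)
  show "- f + f = 0"
    by (rule mfps_eqI) (simp add: plus_mfps_def zero_mfps_def uminus_mfps_def)
  show "f - h = f + - h"
    by (rule mfps_eqI) (simp add: plus_mfps_def minus_mfps_def uminus_mfps_def)
  show "f * h = h * f"
  proof (rule mfps_eqI)
    fix m :: "'a multiset"
    have double_diff: "m - (m - a) = a" if "a \<subseteq># m" for a
      using that by (auto simp: multiset_eq_iff subseteq_mset_def)
    have "(\<Sum>a | a \<subseteq># m. mcoeff f a * mcoeff h (m - a))
        = (\<Sum>a | a \<subseteq># m. mcoeff h a * mcoeff f (m - a))"
    proof (rule sum.reindex_bij_witness[of _ "\<lambda>a. m - a" "\<lambda>a. m - a"])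
      fix a assume "a \<in> {a. a \<subseteq># m}"
      then have a: "m - (m - a) = a" using double_diff by blast
      show "m - (m - a) = a" "m - (m - a) = a" by (fact a)+
      show "m - a \<in> {a. a \<subseteq># m}" "m - a \<in> {a. a \<subseteq># m}" by simp_all
      show "mcoeff h (m - a) * mcoeff f (m - (m - a)) = mcoeff f a * mcoeff h (m - a)"
        unfolding a by (rule mult.commute)
    qed
    then show "mcoeff (f * h) m = mcoeff (h * f) m" by (simp add: times_mfps_def)
  qed
  show "1 * f = f"
  proof (rule mfps_eqI)
    fix m :: "'a multiset"
    have "(\<Sum>a | a \<subseteq># m. (if a = {#} then 1 else 0) * mcoeff f (m - a))
        = (\<Sum>a | a \<subseteq># m. if a = {#} then mcoeff f (m - a) else 0)"
      by (rule sum.cong) auto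
    also have "\<dots> = mcoeff f m" by (simp add: finite_submultisets)
    finally show "mcoeff (1 * f) m = mcoeff f m" by (simp add: times_mfps_def one_mfps_def)
  qed
  show "(f + h) * k = f * k + h * k"
    by (rule mfps_eqI) (simp add: times_mfps_def plus_mfps_def sum.distrib distrib_right)
  show "(0 :: ('a, 'b) mfps) \<noteq> 1"
  proof
    assume "(0 :: ('a, 'b) mfps) = 1"
    then have "mcoeff (0 :: ('a, 'b) mfps) {#} = mcoeff 1 {#}" by simp
    then show False by (simp add: one_mfps_def zero_mfps_def)
  qed
  show "f * h * k = f * (h * k)"
  proof (rule mfps_eqI)
    fix m :: "'a multiset"
    have "mcoeff (f * h * k) m = (\<Sum>a | a \<subseteq># m. \<Sum>b | b \<subseteq># a.
        mcoeff f b * mcoeff h (a - b) * mcoeff k (m - a))"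
      by (simp add: times_mfps_def sum_distrib_right)
    also have "\<dots> = (\<Sum>(a, b)\<in>(SIGMA a:{a. a \<subseteq># m}. {b. b \<subseteq># a}).
        mcoeff f b * mcoeff h (a - b) * mcoeff k (m - a))"
      by (rule sum.Sigma) (auto simp: finite_submultisets)
    also have "\<dots> = (\<Sum>(b, c)\<in>(SIGMA b:{b. b \<subseteq># m}. {c. c \<subseteq># m - b}).
        mcoeff f b * (mcoeff h c * mcoeff k (m - b - c)))"
    proof (rule sum.reindex_bij_witness[of _ "\<lambda>(b, c). (b + c, b)" "\<lambda>(a, b). (b, a - b)"])
      fix p assume p: "p \<in> (SIGMA a:{a. a \<subseteq># m}. {b. b \<subseteq># a})"
      obtain a b where ab: "p = (a, b)" "a \<subseteq># m" "b \<subseteq># a" using p by auto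
      have "b + (a - b) = a" using ab(3) by simp
      then show "(\<lambda>(b, c). (b + c, b)) ((\<lambda>(a, b). (b, a - b)) p) = p" using ab by simp
      have "b \<subseteq># m" using ab by simp
      moreover have "a - b \<subseteq># m - b"
        using ab(2) by (simp add: subseteq_mset_def diff_le_mono)
      ultimately show "(\<lambda>(a, b). (b, a - b)) p \<in> (SIGMA b:{b. b \<subseteq># m}. {c. c \<subseteq># m - b})"
        using ab by simp
      have "m - b - (a - b) = m - a"
        using \<open>b + (a - b) = a\<close> diff_diff_add_mset[of m b "a - b"] by simp
      then show "(case (\<lambda>(a, b). (b, a - b)) p of
            (b, c) \<Rightarrow> mcoeff f b * (mcoeff h c * mcoeff k (m - b - c)))
          = (case p of (a, b) \<Rightarrow> mcoeff f b * mcoeff h (a - b) * mcoeff k (m - a))"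
        using ab by (simp add: mult.assoc)
    next
      fix p assume p: "p \<in> (SIGMA b:{b. b \<subseteq># m}. {c. c \<subseteq># m - b})"
      obtain b c where bc: "p = (b, c)" "b \<subseteq># m" "c \<subseteq># m - b" using p by auto
      show "(\<lambda>(a, b). (b, a - b)) ((\<lambda>(b, c). (b + c, b)) p) = p" using bc by simp
      have "b + c \<subseteq># m"
        using bc by (simp add: subseteq_mset_def) (metis Nat.le_diff_conv2 add.commute)
      then show "(\<lambda>(b, c). (b + c, b)) p \<in> (SIGMA a:{a. a \<subseteq># m}. {b. b \<subseteq># a})"
        using bc by simp
    qed
    also have "\<dots> = (\<Sum>b | b \<subseteq># m. \<Sum>c | c \<subseteq># m - b.
        mcoeff f b * (mcoeff h c * mcoeff k (m - b - c)))"
      by (rule sum.Sigma[symmetric]) (auto simp: finite_submultisets)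
    also have "\<dots> = mcoeff (f * (h * k)) m"
      by (simp add: times_mfps_def sum_distrib_left)
    finally show "mcoeff (f * h * k) m = mcoeff (f * (h * k)) m" .
  qed
qed

end

definition mconst :: "'a \<Rightarrow> ('x, 'a :: zero) mfps" where
  "mconst c = Abs_mfps (\<lambda>m. if m = {#} then c else 0)"

definition mvar :: "'x \<Rightarrow> ('x, 'a :: zero_neq_one) mfps" where
  "mvar x = Abs_mfps (\<lambda>m. if m = {#x#} then 1 else 0)"

text \<open>
  The formal linear form \<open>\<Sum>x\<in>X. c x * x\<close>, where \<open>X\<close> may be infinite: the coefficient of the
  monomial \<open>x\<close> is \<open>c x\<close> for \<open>x \<in> X\<close>, all other coefficients vanish.
\<close>

definition linear_form :: "'x set \<Rightarrow> ('x \<Rightarrow> 'a) \<Rightarrow> ('x, 'a :: comm_monoid_add) mfps" where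
  "linear_form X c = Abs_mfps (\<lambda>m. \<Sum>x | x \<in> X \<and> m = {#x#}. c x)"

lemma linear_form_finite:
  fixes c :: "'x \<Rightarrow> 'a :: comm_ring_1"
  assumes "finite X"
  shows "linear_form X c = (\<Sum>x\<in>X. mvar x * mconst (c x))"
proof (rule mfps_eqI)
  fix m
  have coeff_sum: "mcoeff (\<Sum>x\<in>Y. F x) m = (\<Sum>x\<in>Y. mcoeff (F x) m)"
    for Y and F :: "'x \<Rightarrow> ('x, 'a) mfps"
    by (induction Y rule: infinite_finite_induct) (auto simp: zero_mfps_def plus_mfps_def)
  have coeff_term: "mcoeff (mvar x * mconst (c x)) m = (if m = {#x#} then c x else 0)" for x
  proof -
    have "mcoeff (mvar x * mconst (c x)) m
        = (\<Sum>a | a \<subseteq># m. if a = m then (if m = {#x#} then c x else 0) else 0)"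
      unfolding times_mfps_def mvar_def mconst_def mcoeff_Abs
      by (rule sum.cong) (auto simp: Diff_eq_empty_iff_mset intro: subset_mset.antisym)
    then show ?thesis by (simp add: finite_submultisets)
  qed
  have "(\<Sum>x | x \<in> X \<and> m = {#x#}. c x) = (\<Sum>x\<in>X. if m = {#x#} then c x else 0)"
    using assms by (simp add: sum.If_cases Int_def)
  then show "mcoeff (linear_form X c) m = mcoeff (\<Sum>x\<in>X. mvar x * mconst (c x)) m"
    by (simp add: linear_form_def coeff_sum coeff_term)
qed


section \<open>Minors, traces and inverses of matrices\<close>

definition increasing_seqs :: "nat \<Rightarrow> nat \<Rightarrow> nat list set" where
  "increasing_seqs k n = {is. length is = k \<and> sorted_wrt (<) is \<and> set is \<subseteq> {0..n}}"

definition minor :: "'a :: comm_ring_1 mat \<Rightarrow> nat list \<Rightarrow> nat list \<Rightarrow> 'a" where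
  "minor N is js = det (mat (length is) (length js) (\<lambda>(a, b). N $$ (is ! a, js ! b)))"

definition mtrace :: "'a :: comm_monoid_add mat \<Rightarrow> 'a" where
  "mtrace A = (\<Sum>i<dim_row A. A $$ (i, i))"

text \<open>The two-sided inverse over an arbitrary commutative ring; meaningful if
  \<open>invertible_mat A\<close>.\<close>

definition mat_inv :: "'a :: comm_ring_1 mat \<Rightarrow> 'a mat" where
  "mat_inv A = (THE B. inverts_mat A B \<and> inverts_mat B A)"

lemma mat_inv_eqI:
  assumes "A \<in> carrier_mat d d" "inverts_mat A B" "inverts_mat B A"
  shows "mat_inv A = B"
proof -
  have carr: "C \<in> carrier_mat d d" if "inverts_mat A C" "inverts_mat C A" for C
  proof -
    have "dim_col C = dim_col (A * C)" by simp
    also have "\<dots> = d" using that(1) assms(1) by (simp add: inverts_mat_def)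
    finally have c: "dim_col C = d" .
    have "dim_row C = dim_col (1\<^sub>m (dim_row C) :: 'a mat)" by simp
    also have "\<dots> = dim_col (C * A)" using that(2) by (simp only: inverts_mat_def)
    also have "\<dots> = d" using assms(1) by simp
    finally show ?thesis using c by blast
  qed
  show ?thesis unfolding mat_inv_def
  proof (rule the_equality)
    show "inverts_mat A B \<and> inverts_mat B A" using assms by simp
  next
    fix C assume C: "inverts_mat A C \<and> inverts_mat C A"
    have cB: "B \<in> carrier_mat d d" and cC: "C \<in> carrier_mat d d"
      using carr C assms by blast+
    have "C = C * (A * B)" using assms cC cB by (simp add: inverts_mat_def)
    also have "\<dots> = (C * A) * B" using assms cB cC by (simp add: assoc_mult_mat)
    also have "\<dots> = B" using C cB cC by (simp add: inverts_mat_def)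
    finally show "C = B" .
  qed
qed

definition kronecker :: "'a :: times mat \<Rightarrow> 'a mat \<Rightarrow> 'a mat" where
  "kronecker A B = mat (dim_row A * dim_row B) (dim_col A * dim_col B)
     (\<lambda>(i, j). A $$ (i div dim_row B, j div dim_col B) * B $$ (i mod dim_row B, j mod dim_col B))"


section \<open>Tensor, exterior and symmetric powers of a matrix\<close>

fun tensor_power :: "nat \<Rightarrow> 'a :: comm_ring_1 mat \<Rightarrow> 'a mat" where
  "tensor_power 0 A = 1\<^sub>m 1"
| "tensor_power (Suc m) A = kronecker A (tensor_power m A)"

text \<open>
  A strictly increasing word \<open>w\<close> of length \<open>m\<close> over \<open>{0..<d}\<close> stands for the basis vector
  \<open>e\<^bsub>w ! 0\<^esub> \<and> \<dots> \<and> e\<^bsub>w ! (m - 1)\<^esub>\<close> of the exterior power; in this basis the matrix of the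
  \<open>m\<close>-th exterior power of \<open>A\<close> consists of the \<open>m \<times> m\<close> minors of \<open>A\<close>.
\<close>

definition ext_basis :: "nat \<Rightarrow> nat \<Rightarrow> nat list list" where
  "ext_basis d m = filter (sorted_wrt (<)) (List.n_lists m [0..<d])"

definition ext_power :: "nat \<Rightarrow> 'a :: comm_ring_1 mat \<Rightarrow> 'a mat" where
  "ext_power m A = (let W = ext_basis (dim_row A) m in
     mat (length W) (length W) (\<lambda>(i, j). minor A (W ! i) (W ! j)))"

text \<open>
  A weakly increasing word \<open>w\<close> stands for the monomial \<open>e\<^bsub>w ! 0\<^esub> \<cdots> e\<^bsub>w ! (m - 1)\<^esub>\<close> of the
  symmetric power. The matrix entry below is the coefficient of the \<open>i\<close>-th monomial in the
  product of the vectors \<open>A e\<^bsub>v ! l\<^esub>\<close>, \<open>l < m\<close>, where \<open>v\<close> is the \<open>j\<close>-th word: expanding that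
  product, one collects all words \<open>u\<close> that are rearrangements of the \<open>i\<close>-th one.
\<close>

definition sym_basis :: "nat \<Rightarrow> nat \<Rightarrow> nat list list" where
  "sym_basis d m = filter (sorted_wrt (\<le>)) (List.n_lists m [0..<d])"

definition sym_power :: "nat \<Rightarrow> 'a :: comm_ring_1 mat \<Rightarrow> 'a mat" where
  "sym_power m A = (let W = sym_basis (dim_row A) m in
     mat (length W) (length W)
       (\<lambda>(i, j). \<Sum>u | mset u = mset (W ! i). \<Prod>l<m. A $$ (u ! l, W ! j ! l)))"


section \<open>Complex representations of a group\<close>

definition GL :: "nat \<Rightarrow> complex mat monoid" where
  "GL d = units_of (ring_mat TYPE(complex) d ())"

definition representation ::
    "('g, 'b) monoid_scheme \<Rightarrow> nat \<Rightarrow> ('g \<Rightarrow> complex mat) \<Rightarrow> bool" where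
  "representation G d \<rho> \<longleftrightarrow> \<rho> \<in> hom G (GL d)"

definition faithful :: "('g, 'b) monoid_scheme \<Rightarrow> ('g \<Rightarrow> complex mat) \<Rightarrow> bool" where
  "faithful G \<rho> \<longleftrightarrow> inj_on \<rho> (carrier G)"

definition irreducible_rep ::
    "('g, 'b) monoid_scheme \<Rightarrow> nat \<Rightarrow> ('g \<Rightarrow> complex mat) \<Rightarrow> bool" where
  "irreducible_rep G d \<rho> \<longleftrightarrow> representation G d \<rho> \<and> d > 0 \<and>
     (\<forall>W. VectorSpace.subspace class_ring W (module_vec TYPE(complex) d) \<and>
          (\<forall>g\<in>carrier G. \<forall>v\<in>W. \<rho> g *\<^sub>v v \<in> W) \<longrightarrow>
        W = {0\<^sub>v d} \<or> W = carrier_vec d)"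

definition equivalent_reps :: "('g, 'b) monoid_scheme \<Rightarrow> nat \<Rightarrow> ('g \<Rightarrow> complex mat) \<Rightarrow>
    nat \<Rightarrow> ('g \<Rightarrow> complex mat) \<Rightarrow> bool" where
  "equivalent_reps G d \<rho> e \<sigma> \<longleftrightarrow> d = e \<and>
     (\<exists>P \<in> carrier (GL d). \<forall>g\<in>carrier G. P * \<rho> g = \<sigma> g * P)"

text \<open>\<open>S 0, \<dots>, S n\<close>, of degrees \<open>ds 0, \<dots>, ds n\<close>, are the irreducible representations of \<open>G\<close>
  up to isomorphism, starting with the trivial one.\<close>

definition irreducibles :: "('g, 'b) monoid_scheme \<Rightarrow> nat \<Rightarrow> (nat \<Rightarrow> nat) \<Rightarrow>
    (nat \<Rightarrow> 'g \<Rightarrow> complex mat) \<Rightarrow> bool" where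
  "irreducibles G n ds S \<longleftrightarrow>
     (\<forall>i\<le>n. irreducible_rep G (ds i) (S i)) \<and>
     (\<forall>i\<le>n. \<forall>j\<le>n. equivalent_reps G (ds i) (S i) (ds j) (S j) \<longrightarrow> i = j) \<and>
     (\<forall>d \<rho>. irreducible_rep G d \<rho> \<longrightarrow> (\<exists>i\<le>n. equivalent_reps G d \<rho> (ds i) (S i))) \<and>
     ds 0 = 1 \<and> (\<forall>g\<in>carrier G. S 0 g = 1\<^sub>m 1)"

definition conj_class :: "('g, 'b) monoid_scheme \<Rightarrow> 'g \<Rightarrow> 'g set" where
  "conj_class G x = {h \<otimes>\<^bsub>G\<^esub> x \<otimes>\<^bsub>G\<^esub> inv\<^bsub>G\<^esub> h | h. h \<in> carrier G}"

text \<open>\<open>C 0, \<dots>, C n\<close> are the conjugacy classes of \<open>G\<close>, with representatives \<open>r 0 = 1, \<dots>, r n\<close>.\<close>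

definition conj_class_enum :: "('g, 'b) monoid_scheme \<Rightarrow> nat \<Rightarrow> (nat \<Rightarrow> 'g set) \<Rightarrow>
    (nat \<Rightarrow> 'g) \<Rightarrow> bool" where
  "conj_class_enum G n C r \<longleftrightarrow> bij_betw C {0..n} (conj_class G ` carrier G) \<and>
     (\<forall>j\<le>n. r j \<in> C j) \<and> r 0 = \<one>\<^bsub>G\<^esub>"

definition character :: "('g \<Rightarrow> complex mat) \<Rightarrow> 'g \<Rightarrow> complex" where
  "character \<rho> g = mtrace (\<rho> g)"

definition character_table :: "nat \<Rightarrow> (nat \<Rightarrow> 'g \<Rightarrow> complex mat) \<Rightarrow> (nat \<Rightarrow> 'g) \<Rightarrow> complex mat"
  where "character_table n S r = mat (Suc n) (Suc n) (\<lambda>(i, j). character (S i) (r j))"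

definition scalar_product :: "('g, 'b) monoid_scheme \<Rightarrow> ('g \<Rightarrow> complex) \<Rightarrow> ('g \<Rightarrow> complex) \<Rightarrow>
    complex" where
  "scalar_product G \<phi> \<psi> = 1 / of_nat (card (carrier G)) * (\<Sum>g\<in>carrier G. \<phi> g * cnj (\<psi> g))"

definition tensor_rep :: "('g \<Rightarrow> complex mat) \<Rightarrow> ('g \<Rightarrow> complex mat) \<Rightarrow> 'g \<Rightarrow> complex mat" where
  "tensor_rep \<rho> \<sigma> g = kronecker (\<rho> g) (\<sigma> g)"


section \<open>Clebsch--Gordan matrices\<close>

definition cg_matrix :: "('g, 'b) monoid_scheme \<Rightarrow> nat \<Rightarrow> (nat \<Rightarrow> 'g \<Rightarrow> complex mat) \<Rightarrow>
    ('g \<Rightarrow> complex mat) \<Rightarrow> complex mat" where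
  "cg_matrix G n S \<rho> = mat (Suc n) (Suc n)
     (\<lambda>(i, j). scalar_product G (character (tensor_rep \<rho> (S i))) (character (S j)))"

text \<open>
  Virtual representations are identified with their characters, so that the tensor product
  becomes the pointwise product. On genuine representations this agrees with the definition
  above, as lemma \<open>cg_matrix_eq_virtual\<close> shows.
\<close>

definition cg_matrix_virtual :: "('g, 'b) monoid_scheme \<Rightarrow> nat \<Rightarrow> (nat \<Rightarrow> 'g \<Rightarrow> complex mat) \<Rightarrow>
    ('g \<Rightarrow> complex) \<Rightarrow> complex mat" where
  "cg_matrix_virtual G n S \<phi> = mat (Suc n) (Suc n)
     (\<lambda>(i, j). scalar_product G (\<lambda>g. \<phi> g * character (S i) g) (character (S j)))"

lemma mtrace_kronecker:
  fixes A B :: "'a :: comm_semiring_0 mat"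
  assumes "A \<in> carrier_mat a a" "B \<in> carrier_mat b b"
  shows "mtrace (kronecker A B) = mtrace A * mtrace B"
proof -
  have "mtrace (kronecker A B)
      = (\<Sum>i<a * b. A $$ (i div b, i div b) * B $$ (i mod b, i mod b))"
    using assms by (simp add: mtrace_def kronecker_def)
  also have "\<dots> = (\<Sum>(i, j)\<in>{..<a} \<times> {..<b}. A $$ (i, i) * B $$ (j, j))"
  proof (rule sum.reindex_bij_witness[of _ "\<lambda>(i, j). i * b + j" "\<lambda>i. (i div b, i mod b)"])
    fix i assume "i \<in> {..<a * b}"
    then show "(i div b, i mod b) \<in> {..<a} \<times> {..<b}"
      by (cases "b = 0") (auto simp: less_mult_imp_div_less)
  next
    fix p assume "p \<in> {..<a} \<times> {..<b}"
    then obtain i j where p: "p = (i, j)" "i < a" "j < b" by auto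
    then have "i * b + j < Suc i * b" by simp
    also have "\<dots> \<le> a * b" using p by (intro mult_right_mono) auto
    finally show "(case p of (i, j) \<Rightarrow> i * b + j) \<in> {..<a * b}" using p by simp
    show "((case p of (i, j) \<Rightarrow> i * b + j) div b, (case p of (i, j) \<Rightarrow> i * b + j) mod b) = p"
      using p by simp
  qed auto
  also have "\<dots> = mtrace A * mtrace B"
    using assms by (simp add: mtrace_def sum_product sum.cartesian_product)
  finally show ?thesis .
qed

lemma carrier_GL: "A \<in> carrier (GL d) \<Longrightarrow> A \<in> carrier_mat d d"
  by (auto simp: GL_def units_of_def Units_def ring_mat_def)

lemma cg_matrix_eq_virtual:
  assumes "representation G d \<rho>" "\<And>i. i \<le> n \<Longrightarrow> representation G (ds i) (S i)"
  shows "cg_matrix G n S \<rho> = cg_matrix_virtual G n S (character \<rho>)"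
proof -
  have "character (tensor_rep \<rho> (S i)) g = character \<rho> g * character (S i) g"
    if "i \<le> n" "g \<in> carrier G" for i g
  proof -
    have "\<rho> g \<in> carrier_mat d d" "S i g \<in> carrier_mat (ds i) (ds i)"
      using assms that by (auto simp: representation_def hom_def intro!: carrier_GL)
    then show ?thesis by (simp add: character_def tensor_rep_def mtrace_kronecker)
  qed
  then show ?thesis
    unfolding cg_matrix_def cg_matrix_virtual_def scalar_product_def
    by (intro cong_mat) (auto intro!: sum.cong arg_cong2[where f = "(*)"])
qed

text \<open>The Adams operation: the virtual representation with character \<open>g \<mapsto> tr (\<rho> g)\<^sup>m\<close>.\<close>

definition adams :: "nat \<Rightarrow> ('g \<Rightarrow> complex mat) \<Rightarrow> 'g \<Rightarrow> complex" where
  "adams m \<rho> g = mtrace (\<rho> g ^\<^sub>m m)"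

text \<open>The formal sum \<open>R\<^sub>X = \<Sum>x\<in>X. x R\<^sub>x\<close> is given by \<open>X\<close> and the family \<open>Rx\<close>.\<close>

definition formal_character :: "'x set \<Rightarrow> ('x \<Rightarrow> 'g \<Rightarrow> complex mat) \<Rightarrow> 'g \<Rightarrow>
    ('x, complex) mfps" where
  "formal_character X Rx g = linear_form X (\<lambda>x. character (Rx x) g)"

definition cg_matrix_formal :: "('g, 'b) monoid_scheme \<Rightarrow> nat \<Rightarrow> (nat \<Rightarrow> 'g \<Rightarrow> complex mat) \<Rightarrow>
    'x set \<Rightarrow> ('x \<Rightarrow> 'g \<Rightarrow> complex mat) \<Rightarrow> ('x, complex) mfps mat" where
  "cg_matrix_formal G n S X Rx = mat (Suc n) (Suc n)
     (\<lambda>(i, j). linear_form X (\<lambda>x. cg_matrix G n S (Rx x) $$ (i, j)))"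

text \<open>The matrix \<open>\<Sum>m. N m q\<^sup>m\<close> of formal power series.\<close>

definition matrix_series :: "nat \<Rightarrow> (nat \<Rightarrow> 'a mat) \<Rightarrow> 'a fps mat" where
  "matrix_series n N = mat (Suc n) (Suc n) (\<lambda>(i, j). Abs_fps (\<lambda>m. N m $$ (i, j)))"

definition cg_sym :: "('g, 'b) monoid_scheme \<Rightarrow> nat \<Rightarrow> (nat \<Rightarrow> 'g \<Rightarrow> complex mat) \<Rightarrow>
    ('g \<Rightarrow> complex mat) \<Rightarrow> complex fps mat" where
  "cg_sym G n S R = matrix_series n (\<lambda>m. cg_matrix G n S (\<lambda>g. sym_power m (R g)))"

definition cg_ext :: "('g, 'b) monoid_scheme \<Rightarrow> nat \<Rightarrow> (nat \<Rightarrow> 'g \<Rightarrow> complex mat) \<Rightarrow>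
    ('g \<Rightarrow> complex mat) \<Rightarrow> complex fps mat" where
  "cg_ext G n S R = matrix_series n (\<lambda>m. cg_matrix G n S (\<lambda>g. ext_power m (R g)))"

definition cg_tensor :: "('g, 'b) monoid_scheme \<Rightarrow> nat \<Rightarrow> (nat \<Rightarrow> 'g \<Rightarrow> complex mat) \<Rightarrow>
    ('g \<Rightarrow> complex mat) \<Rightarrow> complex fps mat" where
  "cg_tensor G n S R = matrix_series n (\<lambda>m. cg_matrix G n S (\<lambda>g. tensor_power m (R g)))"

definition cg_adams :: "('g, 'b) monoid_scheme \<Rightarrow> nat \<Rightarrow> (nat \<Rightarrow> 'g \<Rightarrow> complex mat) \<Rightarrow>
    ('g \<Rightarrow> complex mat) \<Rightarrow> complex fps mat" where
  "cg_adams G n S R = matrix_series n (\<lambda>m. cg_matrix_virtual G n S (adams m R))"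

text \<open>The matrix \<open>q A\<close> over formal power series in \<open>q\<close>.\<close>

definition q_mat :: "complex mat \<Rightarrow> complex fps mat" where
  "q_mat A = fps_X \<cdot>\<^sub>m map_mat fps_const A"

end

theory Submission
  imports Defs "Jordan_Normal_Form.Schur_Decomposition"
begin

text \<open>
  Each of the five Clebsch--Gordan matrices is a product \<open>M = \<chi> D \<chi>\<^sup>*\<close>, where \<open>\<chi>\<close> is the character table,
  \<open>\<chi>\<^sup>*\<close> its conjugate transpose, and \<open>D\<close> the diagonal matrix with entries \<open>|C\<^sub>p| \<phi>(g\<^sub>p) / |G|\<close>; here \<open>\<phi>\<close> is the
  character of the representation that is tensored with. Indeed \<open>(R \<otimes> R\<^sub>i, R\<^sub>j)\<close> is the average over the
  group of the class function \<open>\<phi> \<chi>\<^sub>i cnj(\<chi>\<^sub>j)\<close>, and collecting the group elements by conjugacy classes gives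
  the formula (\<open>sum_class_function\<close>, \<open>cg_matrix_virtual_entry\<close>). The Cauchy--Binet formula, with the diagonal
  factor contributing a product of weights, then expands every minor of \<open>M\<close> (\<open>Cauchy_Binet\<close>,
  \<open>minor_weighted_gram\<close>, \<open>minor_class_weights\<close>).

  What remains is to identify \<open>\<phi>\<close> for the four power series. If \<open>A\<close> is the matrix of a group element, the
  claims are
  \<open>\<Sum>m. tr(\<Lambda>\<^sup>m A) q\<^sup>m = det(1 + q A)\<close>, \<open>\<Sum>m. tr(S\<^sup>m A) q\<^sup>m = 1 / det(1 - q A)\<close>,
  \<open>\<Sum>m. tr(A)\<^sup>m q\<^sup>m = 1 / (1 - q tr A)\<close> and \<open>\<Sum>m. tr(A\<^sup>m) q\<^sup>m = tr((1 - q A)\<^sup>-\<^sup>1)\<close>.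
  The last two are geometric series. The first two hold for every complex matrix: both sides depend
  only on the similarity class of \<open>A\<close>, which for the left-hand sides follows from the Cauchy--Binet formula
  and from its analogue for symmetric powers (\<open>perm_minor_mult\<close>). Hence \<open>A\<close> may be taken upper triangular,
  where the traces are the elementary and the complete homogeneous symmetric polynomials of the
  diagonal, and splitting off the largest letter of an increasing word gives the generating functions
  by recursion (\<open>elementary_symmetric_series\<close>, \<open>complete_symmetric_series\<close>). The same invariance under
  similarity shows that all these traces are class functions of the group element.
\<close>

section \<open>Increasing words\<close>

text \<open>
  The index set common to everything below: with \<open>r\<close> equal to \<open><\<close> these words index minors and the
  exterior power, with \<open>\<le>\<close> the symmetric power, and with the full relation all monomials of an expanded
  product of sums.
\<close>

definition words :: "(nat \<Rightarrow> nat \<Rightarrow> bool) \<Rightarrow> nat \<Rightarrow> nat \<Rightarrow> nat list set" where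
  "words r d m = {w. length w = m \<and> sorted_wrt r w \<and> set w \<subseteq> {..<d}}"

lemma finite_words: "finite (words r d m)"
  by (rule finite_subset[OF _ finite_lists_length_eq[of "{..<d}" m]]) (auto simp: words_def)

lemma words_nth: "w \<in> words r d m \<Longrightarrow> l < m \<Longrightarrow> w ! l < d"
  unfolding words_def using nth_mem by blast

lemma increasing_seqs_eq_words: "increasing_seqs k n = words (<) (Suc n) k"
  by (auto simp: increasing_seqs_def words_def)

lemma ext_basis_words: "set (ext_basis d m) = words (<) d m" "distinct (ext_basis d m)"
  by (auto simp: ext_basis_def words_def set_n_lists distinct_n_lists)

lemma sym_basis_words: "set (sym_basis d m) = words (\<le>) d m" "distinct (sym_basis d m)"
  by (auto simp: sym_basis_def words_def set_n_lists distinct_n_lists)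

lemma words_0: "words r d 0 = {[]}"
  by (auto simp: words_def)

lemma prod_sum_words:
  fixes F :: "nat \<Rightarrow> nat \<Rightarrow> 'a :: comm_ring_1"
  shows "(\<Prod>l<m. \<Sum>c<d. F l c) = (\<Sum>u\<in>words (\<lambda>_ _. True) d m. \<Prod>l<m. F l (u ! l))"
proof (induction m)
  case 0
  show ?case by (simp add: words_0)
next
  case (Suc m)
  let ?W = "words (\<lambda>_ _. True) d"
  have "(\<Prod>l<Suc m. \<Sum>c<d. F l c) = (\<Sum>(u, c)\<in>?W m \<times> {..<d}. (\<Prod>l<m. F l (u ! l)) * F m c)"
    by (simp only: prod.lessThan_Suc Suc.IH sum_product sum.cartesian_product)
  also have "\<dots> = (\<Sum>u\<in>?W (Suc m). \<Prod>l<Suc m. F l (u ! l))"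
  proof -
    have bij: "bij_betw (\<lambda>(u, c). u @ [c]) (?W m \<times> {..<d}) (?W (Suc m))"
      unfolding bij_betw_def
    proof
      show "(\<lambda>(u, c). u @ [c]) ` (?W m \<times> {..<d}) = ?W (Suc m)"
      proof (intro equalityI subsetI)
        fix w assume w: "w \<in> ?W (Suc m)"
        then obtain u c where "w = u @ [c]" by (cases w rule: rev_cases) (auto simp: words_def)
        with w show "w \<in> (\<lambda>(u, c). u @ [c]) ` (?W m \<times> {..<d})"
          by (auto simp: words_def sorted_wrt_append image_iff)
      qed (auto simp: words_def sorted_wrt_append)
    qed (auto simp: inj_on_def)
    show ?thesis
      by (subst sum.reindex_bij_betw[OF bij, symmetric], rule sum.cong)
         (auto simp: words_def nth_append intro!: prod.cong)
  qed
  finally show ?case .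
qed

text \<open>
  Every word is a rearrangement of exactly one weakly increasing word, namely its sorted version. This is
  the step that turns an expansion over all words into one over a basis of the symmetric power or, once
  words with a repeated letter drop out, of the exterior power.
\<close>

lemma sum_words_by_sorting:
  fixes f :: "nat list \<Rightarrow> 'a :: comm_monoid_add"
  shows "(\<Sum>u\<in>words (\<lambda>_ _. True) d m. f u) = (\<Sum>w\<in>words (\<le>) d m. \<Sum>u | mset u = mset w. f u)"
proof -
  let ?W = "words (\<lambda>_ _. True) d m"
  have "(\<Sum>u\<in>?W. f u) = (\<Sum>w\<in>words (\<le>) d m. \<Sum>u | u \<in> ?W \<and> sort u = w. f u)"
    by (rule sum.group[symmetric]) (auto simp: finite_words, auto simp: words_def)
  also have "\<dots> = (\<Sum>w\<in>words (\<le>) d m. \<Sum>u | mset u = mset w. f u)"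
  proof (intro sum.cong refl)
    fix w assume w: "w \<in> words (\<le>) d m"
    have "u \<in> ?W \<and> sort u = w \<longleftrightarrow> mset u = mset w" for u
    proof
      assume u: "mset u = mset w"
      have "sort u = w"
        using w u by (intro properties_for_sort) (auto simp: words_def)
      moreover have "u \<in> ?W"
        using w mset_eq_length[OF u] mset_eq_setD[OF u]
        by (auto simp: words_def sorted_wrt_iff_nth_less)
      ultimately show "u \<in> ?W \<and> sort u = w" by simp
    qed (metis mset_sort)
    then show "{u. u \<in> ?W \<and> sort u = w} = {u. mset u = mset w}" by blast
  qed
  finally show ?thesis .
qed

section \<open>The Cauchy--Binet formula\<close>

lemma minor_permute_rows:
  fixes B :: "'a :: comm_ring_1 mat"
  assumes "p permutes {..<k}" "length x = k" "length w = k"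
  shows "minor B (permute_list p x) w = signof p * minor B x w"
proof -
  let ?M = "mat k k (\<lambda>(a, b). B $$ (x ! a, w ! b))"
  have "minor B (permute_list p x) w = det (mat k k (\<lambda>(a, b). ?M $$ (p a, b)))"
    unfolding minor_def using assms permutes_in_image[OF assms(1)]
    by (intro arg_cong[where f = det] cong_mat) (auto simp: permute_list_nth)
  also have "\<dots> = signof p * det ?M"
    by (rule det_permute_rows) (use assms in \<open>auto simp: atLeast0LessThan\<close>)
  finally show ?thesis using assms by (simp add: minor_def)
qed

lemma minor_not_distinct:
  fixes B :: "'a :: comm_ring_1 mat"
  assumes "\<not> distinct x" "length x = k" "length w = k"
  shows "minor B x w = 0"
proof -
  obtain a b where ab: "a < k" "b < k" "a \<noteq> b" "x ! a = x ! b"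
    using assms by (auto simp: distinct_conv_nth)
  show ?thesis unfolding minor_def
    by (rule det_identical_rows[of _ k a b]) (use assms ab in \<open>auto intro!: eq_vecI\<close>)
qed

lemma permute_list_bij:
  assumes "distinct x"
  shows "bij_betw (\<lambda>p. permute_list p x) {p. p permutes {..<length x}} {u. mset u = mset x}"
proof (rule bij_betwI')
  fix p q assume p: "p \<in> {p. p permutes {..<length x}}" and q: "q \<in> {p. p permutes {..<length x}}"
  show "permute_list p x = permute_list q x \<longleftrightarrow> p = q"
  proof
    assume eq: "permute_list p x = permute_list q x"
    show "p = q"
    proof
      fix i
      show "p i = q i"
      proof (cases "i < length x")
        case True
        then have "x ! p i = x ! q i"
          using p q eq by (metis mem_Collect_eq permute_list_nth)
        moreover have "p i < length x" "q i < length x"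
          using True p q permutes_in_image[of _ "{..<length x}" i] by auto
        ultimately show ?thesis using assms nth_eq_iff_index_eq by blast
      next
        case False
        then show ?thesis using p q by (metis lessThan_iff mem_Collect_eq permutes_not_in)
      qed
    qed
  qed simp
next
  fix u assume "u \<in> {u. mset u = mset x}"
  then show "\<exists>p\<in>{p. p permutes {..<length x}}. u = permute_list p x"
    by (metis mem_Collect_eq mset_eq_permutation)
qed simp

text \<open>
  Expand the rows of the product multilinearly: one obtains a sum over all words \<open>u\<close> of a monomial in \<open>A\<close>
  times the minor of \<open>B\<close> with rows \<open>u\<close>. Words with a repeated letter contribute nothing; the others are
  grouped by their sorted rearrangement \<open>x\<close>, and the permutations sorting them assemble the monomials in \<open>A\<close>,
  with signs, into the minor of \<open>A\<close> with columns \<open>x\<close>.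
\<close>

lemma Cauchy_Binet:
  fixes A B :: "'a :: comm_ring_1 mat"
  assumes A: "A \<in> carrier_mat a d" and B: "B \<in> carrier_mat d b"
    and v: "v \<in> words r a k" and w: "w \<in> words s b k"
  shows "minor (A * B) v w = (\<Sum>x\<in>words (<) d k. minor A v x * minor B x w)"
proof -
  have lv: "length v = k" and lw: "length w = k" using v w by (auto simp: words_def)
  define f where "f u = (\<Prod>l<k. A $$ (v ! l, u ! l)) * minor B u w" for u
  have "minor (A * B) v w = (\<Sum>p | p permutes {0..<k}. signof p *
      (\<Prod>l<k. \<Sum>c<d. A $$ (v ! l, c) * B $$ (c, w ! p l)))"
    unfolding minor_def lv lw
    by (subst det_def'[of _ k])
       (use A B words_nth[OF v] words_nth[OF w] in
          \<open>auto intro!: sum.cong prod.cong simp: scalar_prod_def atLeast0LessThan\<close>)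
  also have "\<dots> = (\<Sum>p | p permutes {0..<k}. \<Sum>u\<in>words (\<lambda>_ _. True) d k. 
      (\<Prod>l<k. A $$ (v ! l, u ! l)) * (signof p * (\<Prod>l<k. B $$ (u ! l, w ! p l))))"
    by (simp add: prod_sum_words sum_distrib_left prod.distrib mult_ac)
  also have "\<dots> = (\<Sum>u\<in>words (\<lambda>_ _. True) d k. f u)"
  proof (subst sum.swap, intro sum.cong refl)
    fix u assume u: "u \<in> words (\<lambda>_ _. True) d k"
    then have "minor B u w = (\<Sum>p | p permutes {0..<k}. signof p * (\<Prod>l<k. B $$ (u ! l, w ! p l)))"
      unfolding minor_def
      by (subst det_def'[of _ k])
         (use lw in \<open>auto simp: words_def intro!: sum.cong prod.cong simp: atLeast0LessThan\<close>)
    then show "(\<Sum>p | p permutes {0..<k}.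
        (\<Prod>l<k. A $$ (v ! l, u ! l)) * (signof p * (\<Prod>l<k. B $$ (u ! l, w ! p l)))) = f u"
      by (simp add: f_def sum_distrib_left)
  qed
  also have "\<dots> = (\<Sum>x\<in>words (\<le>) d k. \<Sum>u | mset u = mset x. f u)"
    by (rule sum_words_by_sorting)
  also have "\<dots> = (\<Sum>x\<in>words (<) d k. \<Sum>u | mset u = mset x. f u)"
  proof (rule sum.mono_neutral_right)
    show "\<forall>x\<in>words (\<le>) d k - words (<) d k. (\<Sum>u | mset u = mset x. f u) = 0"
    proof (intro ballI sum.neutral)
      fix x u assume x: "x \<in> words (\<le>) d k - words (<) d k" and u: "u \<in> {u. mset u = mset x}"
      then have "\<not> distinct x" "length x = k"
        by (auto simp: words_def strict_sorted_iff)
      then show "f u = 0"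
        using u minor_not_distinct[of u k w B] lw mset_eq_length[of u x] mset_eq_imp_distinct_iff[of u x]
        by (simp add: f_def)
    qed
  qed (auto simp: finite_words, auto simp: words_def strict_sorted_iff)
  also have "\<dots> = (\<Sum>x\<in>words (<) d k. minor A v x * minor B x w)"
  proof (intro sum.cong refl)
    fix x assume "x \<in> words (<) d k"
    then have x: "distinct x" "length x = k" by (auto simp: words_def strict_sorted_iff)
    have "(\<Sum>u | mset u = mset x. f u) = (\<Sum>p | p permutes {..<k}. f (permute_list p x))"
      using sum.reindex_bij_betw[OF permute_list_bij[OF x(1)], of f] x(2) by simp
    also have "\<dots> = (\<Sum>p | p permutes {..<k}. (signof p * (\<Prod>l<k. A $$ (v ! l, x ! p l))) * minor B x w)"
      by (intro sum.cong refl)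
         (use x lw in \<open>auto simp: f_def minor_permute_rows permute_list_nth intro!: prod.cong\<close>)
    also have "\<dots> = minor A v x * minor B x w"
      unfolding minor_def[of A] lv x(2)
      by (subst det_def'[of _ k])
         (auto simp: sum_distrib_right atLeast0LessThan intro!: sum.cong prod.cong
           dest: permutes_in_image)
    finally show "(\<Sum>u | mset u = mset x. f u) = minor A v x * minor B x w" .
  qed
  finally show ?thesis .
qed

text \<open>
  Cauchy--Binet for \<open>A D B\<^sup>T\<close> with \<open>D\<close> diagonal. The Clebsch--Gordan matrices have precisely this shape, with
  \<open>A\<close> the character table and \<open>B\<close> its complex conjugate.
\<close>

lemma minor_weighted_gram:
  fixes A B :: "'a :: comm_ring_1 mat"
  assumes A: "A \<in> carrier_mat N N" and B: "B \<in> carrier_mat N N"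
    and v: "v \<in> words r N k" and w: "w \<in> words s N k"
  shows "minor (mat N N (\<lambda>(i, j). \<Sum>p<N. A $$ (i, p) * F p * B $$ (j, p))) v w
    = (\<Sum>x\<in>words (<) N k. minor A v x * minor B w x * (\<Prod>l<k. F (x ! l)))"
proof -
  let ?D = "mat N N (\<lambda>(p, j). F p * B $$ (j, p))"
  have lw: "length w = k" using w by (simp add: words_def)
  have "mat N N (\<lambda>(i, j). \<Sum>p<N. A $$ (i, p) * F p * B $$ (j, p)) = A * ?D"
    using A by (intro eq_matI) (auto simp: scalar_prod_def atLeast0LessThan mult.assoc)
  moreover have "minor ?D x w = minor B w x * (\<Prod>l<k. F (x ! l))" if x: "x \<in> words (<) N k" for x
  proof -
    have lx: "length x = k" using x by (simp add: words_def)
    have "minor ?D x w = (\<Sum>p | p permutes {0..<k}.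
        signof p * (\<Prod>l<k. F (x ! l) * B $$ (w ! p l, x ! l)))"
      unfolding minor_def lx lw using words_nth[OF x] words_nth[OF w]
      by (subst det_def'[of _ k]) (auto intro!: sum.cong prod.cong simp: atLeast0LessThan)
    also have "\<dots> = (\<Sum>p | p permutes {0..<k}. signof p * (\<Prod>l<k. B $$ (w ! p l, x ! l)))
        * (\<Prod>l<k. F (x ! l))"
      by (simp add: prod.distrib sum_distrib_left mult_ac)
    also have "(\<Sum>p | p permutes {0..<k}. signof p * (\<Prod>l<k. B $$ (w ! p l, x ! l))) = minor B w x"
      unfolding minor_def lx lw
      by (subst det_col[of _ k]) (auto intro!: sum.cong prod.cong simp: atLeast0LessThan dest: permutes_in_image)
    finally show ?thesis .
  qed
  ultimately show ?thesis
    using Cauchy_Binet[OF A _ v w, of ?D] by (simp add: mult.assoc)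
qed

lemma minor_map_mat:
  assumes "comm_ring_hom h" "A \<in> carrier_mat N N" "v \<in> words r N k" "w \<in> words s N k"
  shows "minor (map_mat h A) v w = h (minor A v w)"
proof -
  interpret comm_ring_hom h by fact
  have "mat (length v) (length w) (\<lambda>(a, b). map_mat h A $$ (v ! a, w ! b))
      = map_mat h (mat (length v) (length w) (\<lambda>(a, b). A $$ (v ! a, w ! b)))"
    using assms words_nth[OF assms(3)] words_nth[OF assms(4)]
    by (intro eq_matI) (auto simp: words_def)
  then show ?thesis by (simp add: minor_def)
qed

section \<open>Multiplicativity of the symmetric power\<close>

text \<open>
  The entries of the symmetric power. The sum runs over the distinct rearrangements of \<open>v\<close>, so that this is
  a permanent divided by the order of the stabiliser of \<open>v\<close>. With this asymmetric normalisation,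
  multiplicativity holds without multinomial weights and in every characteristic.
\<close>

definition perm_minor :: "'a :: comm_ring_1 mat \<Rightarrow> nat list \<Rightarrow> nat list \<Rightarrow> 'a" where
  "perm_minor A v w = (\<Sum>u | mset u = mset v. \<Prod>l<length w. A $$ (u ! l, w ! l))"

text \<open>
  Reordering the factors of a product permutes its row word and its column word simultaneously, and the
  row words, being all rearrangements of \<open>v\<close>, are thereby only permuted among themselves.
\<close>

lemma perm_minor_permute_col:
  fixes A :: "'a :: comm_ring_1 mat"
  assumes v: "length v = length x" and u: "mset u = mset x"
  shows "perm_minor A v u = perm_minor A v x"
proof -
  obtain p where p: "p permutes {..<length x}" and up: "u = permute_list p x"
    using mset_eq_permutation[OF u] by metis
  let ?q = "Hilbert_Choice.inv p"
  have q: "?q permutes {..<length x}" using p by (rule permutes_inv)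
  have inv: "permute_list p (permute_list ?q z) = z" "permute_list ?q (permute_list p z) = z"
    if "length z = length x" for z :: "nat list"
    using permute_list_compose[of p z ?q] permute_list_compose[of ?q z p] p q that
    by (simp_all add: permutes_inv_o)
  have bij: "bij_betw (permute_list p) {z. mset z = mset v} {z. mset z = mset v}"
  proof (rule bij_betw_byWitness[where f' = "permute_list ?q"])
    have len: "length z = length x" if "mset z = mset v" for z
      using mset_eq_length[OF that] v by simp
    then show "\<forall>z\<in>{z. mset z = mset v}. permute_list ?q (permute_list p z) = z"
      "\<forall>z\<in>{z. mset z = mset v}. permute_list p (permute_list ?q z) = z"
      using inv by blast+
    show "permute_list p ` {z. mset z = mset v} \<subseteq> {z. mset z = mset v}"
      "permute_list ?q ` {z. mset z = mset v} \<subseteq> {z. mset z = mset v}"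
      using p q len by auto
  qed
  have "perm_minor A v u = (\<Sum>z | mset z = mset v. \<Prod>l<length x. A $$ (permute_list p z ! l, x ! p l))"
    unfolding perm_minor_def using p up
    by (subst sum.reindex_bij_betw[OF bij, symmetric])
       (auto simp: permute_list_nth intro!: sum.cong prod.cong)
  also have "\<dots> = (\<Sum>z | mset z = mset v. \<Prod>l<length x. A $$ (z ! p l, x ! p l))"
  proof (intro sum.cong prod.cong refl)
    fix z l assume z: "z \<in> {z. mset z = mset v}" and l: "l \<in> {..<length x}"
    then have "length z = length x" using mset_eq_length[of z v] v by simp
    then show "A $$ (permute_list p z ! l, x ! p l) = A $$ (z ! p l, x ! p l)"
      using p l by (simp add: permute_list_nth)
  qed
  also have "\<dots> = perm_minor A v x"
    unfolding perm_minor_def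
    by (intro sum.cong refl prod.reindex_bij_betw[OF permutes_imp_bij[OF p], of "\<lambda>l. A $$ (_ l, x ! l)"])
  finally show ?thesis .
qed

text \<open>
  The analogue of Cauchy--Binet that expresses functoriality of the symmetric power. Here words with
  repeated letters survive, and the column words are grouped by sorting, using that \<open>perm_minor\<close> does not
  depend on the order of its columns.
\<close>

lemma perm_minor_mult:
  fixes A B :: "'a :: comm_ring_1 mat"
  assumes A: "A \<in> carrier_mat a d" and B: "B \<in> carrier_mat d b"
    and v: "v \<in> words r a k" and w: "w \<in> words s b k"
  shows "perm_minor (A * B) v w = (\<Sum>x\<in>words (\<le>) d k. perm_minor A v x * perm_minor B x w)"
proof -
  have lv: "length v = k" and lw: "length w = k" using v w by (auto simp: words_def)
  define f where "f t = perm_minor A v t * (\<Prod>l<k. B $$ (t ! l, w ! l))" for t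
  have u_less: "u ! l < a" if "mset u = mset v" "l < k" for u l
  proof -
    have "u ! l \<in> set v" using that lv mset_eq_length mset_eq_setD nth_mem by metis
    then show ?thesis using v by (auto simp: words_def)
  qed
  have "perm_minor (A * B) v w
      = (\<Sum>u | mset u = mset v. \<Prod>l<k. \<Sum>c<d. A $$ (u ! l, c) * B $$ (c, w ! l))"
    unfolding perm_minor_def lw
    using A B words_nth[OF w] u_less
    by (intro sum.cong prod.cong refl) (auto simp: scalar_prod_def atLeast0LessThan)
  also have "\<dots> = (\<Sum>u | mset u = mset v. \<Sum>t\<in>words (\<lambda>_ _. True) d k.
      (\<Prod>l<k. A $$ (u ! l, t ! l)) * (\<Prod>l<k. B $$ (t ! l, w ! l)))"
    by (simp only: prod_sum_words prod.distrib)
  also have "\<dots> = (\<Sum>t\<in>words (\<lambda>_ _. True) d k. f t)"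
    by (subst sum.swap) (auto simp: f_def perm_minor_def sum_distrib_right words_def intro!: sum.cong)
  also have "\<dots> = (\<Sum>x\<in>words (\<le>) d k. \<Sum>t | mset t = mset x. f t)"
    by (rule sum_words_by_sorting)
  also have "\<dots> = (\<Sum>x\<in>words (\<le>) d k. perm_minor A v x * perm_minor B x w)"
  proof (intro sum.cong refl)
    fix x assume "x \<in> words (\<le>) d k"
    then have "length x = k" by (simp add: words_def)
    then have "f t = perm_minor A v x * (\<Prod>l<k. B $$ (t ! l, w ! l))" if "mset t = mset x" for t
      using perm_minor_permute_col[of v x t A] lv that by (simp add: f_def)
    then show "(\<Sum>t | mset t = mset x. f t) = perm_minor A v x * perm_minor B x w"
      by (simp add: perm_minor_def[of B] lw sum_distrib_left)
  qed
  finally show ?thesis .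
qed

section \<open>Traces of powers as similarity invariants\<close>

lemma square_ext_power: "square_mat (ext_power m A)"
  by (simp add: ext_power_def Let_def)

lemma mtrace_ext_power:
  assumes "A \<in> carrier_mat d d"
  shows "mtrace (ext_power m A) = (\<Sum>w\<in>words (<) d m. minor A w w)"
proof -
  have "mtrace (ext_power m A) = (\<Sum>i<length (ext_basis d m). minor A (ext_basis d m ! i) (ext_basis d m ! i))"
    using assms by (simp add: mtrace_def ext_power_def Let_def)
  also have "\<dots> = (\<Sum>w\<leftarrow>ext_basis d m. minor A w w)"
    by (simp add: sum_list_sum_nth atLeast0LessThan)
  also have "\<dots> = (\<Sum>w\<in>words (<) d m. minor A w w)"
    by (simp add: sum_list_distinct_conv_sum_set ext_basis_words)
  finally show ?thesis .
qed

lemma square_sym_power: "square_mat (sym_power m A)"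
  by (simp add: sym_power_def Let_def)

lemma mtrace_sym_power:
  assumes "A \<in> carrier_mat d d"
  shows "mtrace (sym_power m A) = (\<Sum>w\<in>words (\<le>) d m. perm_minor A w w)"
proof -
  let ?W = "sym_basis d m"
  have "length (?W ! i) = m" if "i < length ?W" for i
    using nth_mem[OF that] by (simp add: sym_basis_words words_def)
  then have "mtrace (sym_power m A) = (\<Sum>i<length ?W. perm_minor A (?W ! i) (?W ! i))"
    using assms by (simp add: mtrace_def sym_power_def Let_def perm_minor_def)
  also have "\<dots> = (\<Sum>w\<leftarrow>?W. perm_minor A w w)"
    by (simp add: sum_list_sum_nth atLeast0LessThan)
  also have "\<dots> = (\<Sum>w\<in>words (\<le>) d m. perm_minor A w w)"
    by (simp add: sum_list_distinct_conv_sum_set sym_basis_words)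
  finally show ?thesis .
qed

lemma mtrace_mult_comm:
  fixes A B :: "'a :: comm_ring_1 mat"
  assumes "A \<in> carrier_mat a d" "B \<in> carrier_mat d a"
  shows "mtrace (A * B) = mtrace (B * A)"
proof -
  have "mtrace (A * B) = (\<Sum>i<a. \<Sum>j<d. A $$ (i, j) * B $$ (j, i))"
    using assms by (auto simp: mtrace_def scalar_prod_def atLeast0LessThan intro!: sum.cong)
  also have "\<dots> = (\<Sum>j<d. \<Sum>i<a. B $$ (j, i) * A $$ (i, j))"
    by (subst sum.swap) (simp add: mult.commute)
  also have "\<dots> = mtrace (B * A)"
    using assms by (auto simp: mtrace_def scalar_prod_def atLeast0LessThan intro!: sum.cong)
  finally show ?thesis .
qed

text \<open>
  A quantity with \<open>F (A B) = F (B A)\<close> is a similarity invariant, because \<open>P B Q\<close> and \<open>Q P B = B\<close> give the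
  same value. For traces of exterior and symmetric powers the hypothesis follows from the two
  multiplication formulas above, without passing through the matrices of the powers themselves.
\<close>

lemma similar_invariant:
  fixes F :: "'a :: comm_ring_1 mat \<Rightarrow> 'b"
  assumes comm: "\<And>n A B. A \<in> carrier_mat n n \<Longrightarrow> B \<in> carrier_mat n n \<Longrightarrow> F (A * B) = F (B * A)"
    and "similar_mat A B"
  shows "F A = F B"
proof -
  obtain n P Q where c: "{A, B, P, Q} \<subseteq> carrier_mat n n"
    and PQ: "P * Q = 1\<^sub>m n" "Q * P = 1\<^sub>m n" "A = P * B * Q"
    using similar_matD[OF assms(2)] by blast
  then have A: "A \<in> carrier_mat n n" and B: "B \<in> carrier_mat n n"
    and P: "P \<in> carrier_mat n n" and Q: "Q \<in> carrier_mat n n" by auto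
  have "F A = F (Q * (P * B))" unfolding PQ(3) using P B Q by (intro comm) auto
  also have "Q * (P * B) = B" using P B Q PQ by (simp flip: assoc_mult_mat)
  finally show ?thesis .
qed

lemma mtrace_similar:
  fixes A B :: "'a :: comm_ring_1 mat"
  assumes "similar_mat A B"
  shows "mtrace A = mtrace B"
  by (rule similar_invariant[of mtrace, OF _ assms]) (rule mtrace_mult_comm)

lemma mtrace_ext_power_similar:
  fixes A B :: "'a :: comm_ring_1 mat"
  assumes "similar_mat A B"
  shows "mtrace (ext_power m A) = mtrace (ext_power m B)"
proof (rule similar_invariant[of "\<lambda>A. mtrace (ext_power m A)", OF _ assms])
  fix n and A B :: "'a mat" assume A: "A \<in> carrier_mat n n" and B: "B \<in> carrier_mat n n"
  let ?W = "words (<) n m"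
  have "(\<Sum>w\<in>?W. minor (A * B) w w) = (\<Sum>w\<in>?W. \<Sum>x\<in>?W. minor A w x * minor B x w)"
    by (intro sum.cong refl Cauchy_Binet[OF A B])
  also have "\<dots> = (\<Sum>x\<in>?W. \<Sum>w\<in>?W. minor B x w * minor A w x)"
    by (subst sum.swap) (simp add: mult.commute)
  also have "\<dots> = (\<Sum>w\<in>?W. minor (B * A) w w)"
    by (intro sum.cong refl Cauchy_Binet[OF B A, symmetric])
  finally show "mtrace (ext_power m (A * B)) = mtrace (ext_power m (B * A))"
    using A B by (simp add: mtrace_ext_power[of _ n])
qed

lemma mtrace_sym_power_similar:
  fixes A B :: "'a :: comm_ring_1 mat"
  assumes "similar_mat A B"
  shows "mtrace (sym_power m A) = mtrace (sym_power m B)"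
proof (rule similar_invariant[of "\<lambda>A. mtrace (sym_power m A)", OF _ assms])
  fix n and A B :: "'a mat" assume A: "A \<in> carrier_mat n n" and B: "B \<in> carrier_mat n n"
  let ?W = "words (\<le>) n m"
  have "(\<Sum>w\<in>?W. perm_minor (A * B) w w) = (\<Sum>w\<in>?W. \<Sum>x\<in>?W. perm_minor A w x * perm_minor B x w)"
    by (intro sum.cong refl perm_minor_mult[OF A B])
  also have "\<dots> = (\<Sum>x\<in>?W. \<Sum>w\<in>?W. perm_minor B x w * perm_minor A w x)"
    by (subst sum.swap) (simp add: mult.commute)
  also have "\<dots> = (\<Sum>w\<in>?W. perm_minor (B * A) w w)"
    by (intro sum.cong refl perm_minor_mult[OF B A, symmetric])
  finally show "mtrace (sym_power m (A * B)) = mtrace (sym_power m (B * A))"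
    using A B by (simp add: mtrace_sym_power[of _ n])
qed

section \<open>Powers of triangular matrices\<close>

lemma minor_upper_triangular:
  fixes T :: "'a :: comm_ring_1 mat"
  assumes T: "T \<in> carrier_mat d d" "upper_triangular T" and w: "w \<in> words (<) d m"
  shows "minor T w w = (\<Prod>i\<leftarrow>w. T $$ (i, i))"
proof -
  let ?M = "mat (length w) (length w) (\<lambda>(a, b). T $$ (w ! a, w ! b))"
  have lt: "w ! b < w ! a" "w ! a < d" if "b < a" "a < length w" for a b
    using w that words_nth[OF w] sorted_wrt_nth_less[of "(<)" w b a] by (auto simp: words_def)
  have "upper_triangular ?M"
    using T lt by (intro upper_triangularI) auto
  then have "minor T w w = prod_list (diag_mat ?M)"
    unfolding minor_def by (intro det_upper_triangular[of _ "length w"]) auto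
  also have "diag_mat ?M = map (\<lambda>i. T $$ (i, i)) w"
    by (intro nth_equalityI) (auto simp: diag_mat_def)
  finally show ?thesis .
qed

text \<open>
  A rearrangement \<open>u\<close> of \<open>w\<close> contributes only if \<open>u\<close> is bounded by \<open>w\<close> in every position. Both words have the
  same sum of letters, hence \<open>u = w\<close> and the diagonal product alone remains.
\<close>

lemma perm_minor_upper_triangular:
  fixes T :: "'a :: comm_ring_1 mat"
  assumes T: "T \<in> carrier_mat d d" "upper_triangular T" and w: "w \<in> words r d m"
  shows "perm_minor T w w = (\<Prod>i\<leftarrow>w. T $$ (i, i))"
proof -
  have "(\<Prod>l<length w. T $$ (u ! l, w ! l)) = 0" if u: "mset u = mset w" "u \<noteq> w" for u
  proof -
    have len: "length u = length w" using u(1) by (rule mset_eq_length)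
    have "\<exists>l<length w. w ! l < u ! l"
    proof (rule ccontr)
      assume "\<not> ?thesis"
      then have le: "\<And>l. l \<in> {..<length w} \<Longrightarrow> u ! l \<le> w ! l" by (meson lessThan_iff not_less)
      have "sum_list u = sum_list w" using u(1) by (metis sum_mset_sum_list)
      then have "(\<Sum>l<length w. u ! l) = (\<Sum>l<length w. w ! l)"
        by (simp add: sum_list_sum_nth len atLeast0LessThan)
      then have "u ! l = w ! l" if "l < length w" for l
        using sum_mono_inv[of "(!) u" "{..<length w}" "(!) w" l] le that by simp
      then have "u = w" using len by (intro nth_equalityI) auto
      then show False using u(2) by simp
    qed
    then obtain l where l: "l < length w" "w ! l < u ! l" by blast
    have "u ! l \<in> set w" using l len mset_eq_setD[OF u(1)] nth_mem by metis
    then have "u ! l < d" using w by (auto simp: words_def)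
    then have "T $$ (u ! l, w ! l) = 0" using T l by auto
    then show ?thesis using l by (intro prod_zero) auto
  qed
  then have "perm_minor T w w = (\<Sum>u\<in>{w}. \<Prod>l<length w. T $$ (u ! l, w ! l))"
    unfolding perm_minor_def
    by (intro sum.mono_neutral_right) (auto simp: mset_eq_finite)
  also have "\<dots> = (\<Prod>i\<leftarrow>w. T $$ (i, i))"
    by (simp add: prod.list_conv_set_nth atLeast0LessThan)
  finally show ?thesis .
qed

section \<open>Generating functions of the traces\<close>

lemma words_zero_letters: "words r 0 m = (if m = 0 then {[]} else {})"
  by (auto simp: words_def)

text \<open>
  Split off the last letter if it is the largest possible one. A strictly increasing word cannot use it
  again, a weakly increasing word can; this is the whole difference between the generating
  functions \<open>\<Prod>i. (1 + e i q)\<close> and \<open>\<Prod>i. 1 / (1 - e i q)\<close>.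
\<close>

lemma words_strict_Suc:
  "words (<) (Suc d) (Suc m) = words (<) d (Suc m) \<union> (\<lambda>u. u @ [d]) ` words (<) d m"
proof (intro equalityI subsetI)
  fix w assume w: "w \<in> words (<) (Suc d) (Suc m)"
  then obtain u c where "w = u @ [c]" by (cases w rule: rev_cases) (auto simp: words_def)
  with w have u: "length u = m" "sorted_wrt (<) u" "\<forall>x\<in>set u. x < c" "c < Suc d" "w = u @ [c]"
    by (auto simp: words_def sorted_wrt_append)
  show "w \<in> words (<) d (Suc m) \<union> (\<lambda>u. u @ [d]) ` words (<) d m"
  proof (cases "c = d")
    case True
    then have "u \<in> words (<) d m" using u by (auto simp: words_def)
    then show ?thesis using True u by blast
  next
    case False
    then have "\<forall>x\<in>set u. x < d" "c < d" using u by auto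
    then show ?thesis using u by (auto simp: words_def sorted_wrt_append)
  qed
qed (auto simp: words_def sorted_wrt_append)

lemma words_weak_Suc:
  "words (\<le>) (Suc d) (Suc m) = words (\<le>) d (Suc m) \<union> (\<lambda>u. u @ [d]) ` words (\<le>) (Suc d) m"
proof (intro equalityI subsetI)
  fix w assume w: "w \<in> words (\<le>) (Suc d) (Suc m)"
  then obtain u c where "w = u @ [c]" by (cases w rule: rev_cases) (auto simp: words_def)
  with w have u: "length u = m" "sorted_wrt (\<le>) u" "\<forall>x\<in>set u. x \<le> c" "c < Suc d" "w = u @ [c]"
    by (auto simp: words_def sorted_wrt_append)
  show "w \<in> words (\<le>) d (Suc m) \<union> (\<lambda>u. u @ [d]) ` words (\<le>) (Suc d) m"
  proof (cases "c = d")
    case True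
    then have "u \<in> words (\<le>) (Suc d) m" using u by (auto simp: words_def)
    then show ?thesis using True u by blast
  next
    case False
    then have "\<forall>x\<in>set u. x < d" "c < d" using u by auto
    then show ?thesis using u by (auto simp: words_def sorted_wrt_append)
  qed
qed (auto simp: words_def sorted_wrt_append subset_iff less_Suc_eq_le)

lemma elementary_symmetric_series:
  fixes e :: "nat \<Rightarrow> 'a :: comm_ring_1"
  shows "Abs_fps (\<lambda>m. \<Sum>w\<in>words (<) d m. \<Prod>i\<leftarrow>w. e i) = (\<Prod>i<d. 1 + fps_X * fps_const (e i))"
proof (induction d)
  case 0
  show ?case by (rule fps_ext) (simp add: words_zero_letters)
next
  case (Suc d)
  let ?E = "\<lambda>d. Abs_fps (\<lambda>m. \<Sum>w\<in>words (<) d m. \<Prod>i\<leftarrow>w. e i)"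
  have "?E (Suc d) = ?E d + fps_X * (fps_const (e d) * ?E d)"
  proof (rule fps_ext)
    fix m
    show "fps_nth (?E (Suc d)) m = fps_nth (?E d + fps_X * (fps_const (e d) * ?E d)) m"
    proof (cases m)
      case (Suc l)
      have "words (<) d (Suc l) \<inter> (\<lambda>u. u @ [d]) ` words (<) d l = {}"
        by (auto simp: words_def)
      then have "fps_nth (?E (Suc d)) (Suc l) = fps_nth (?E d) (Suc l) + (\<Sum>w\<in>(\<lambda>u. u @ [d]) ` words (<) d l. \<Prod>i\<leftarrow>w. e i)"
        by (simp add: words_strict_Suc sum.union_disjoint finite_words)
      also have "(\<Sum>w\<in>(\<lambda>u. u @ [d]) ` words (<) d l. \<Prod>i\<leftarrow>w. e i) = e d * fps_nth (?E d) l"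
        by (subst sum.reindex) (auto simp: inj_on_def sum_distrib_left mult.commute)
      finally show ?thesis using Suc by simp
    qed (simp add: words_0)
  qed
  then show ?case using Suc by (simp add: algebra_simps)
qed

lemma complete_symmetric_series:
  fixes e :: "nat \<Rightarrow> 'a :: comm_ring_1"
  shows "Abs_fps (\<lambda>m. \<Sum>w\<in>words (\<le>) d m. \<Prod>i\<leftarrow>w. e i) * (\<Prod>i<d. 1 - fps_X * fps_const (e i)) = 1"
proof (induction d)
  case 0
  show ?case by (rule fps_ext) (simp add: words_zero_letters)
next
  case (Suc d)
  let ?H = "\<lambda>d. Abs_fps (\<lambda>m. \<Sum>w\<in>words (\<le>) d m. \<Prod>i\<leftarrow>w. e i)"
  have "?H (Suc d) = ?H d + fps_X * (fps_const (e d) * ?H (Suc d))"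
  proof (rule fps_ext)
    fix m
    show "fps_nth (?H (Suc d)) m = fps_nth (?H d + fps_X * (fps_const (e d) * ?H (Suc d))) m"
    proof (cases m)
      case (Suc l)
      have "words (\<le>) d (Suc l) \<inter> (\<lambda>u. u @ [d]) ` words (\<le>) (Suc d) l = {}"
        by (auto simp: words_def)
      then have "fps_nth (?H (Suc d)) (Suc l)
          = fps_nth (?H d) (Suc l) + (\<Sum>w\<in>(\<lambda>u. u @ [d]) ` words (\<le>) (Suc d) l. \<Prod>i\<leftarrow>w. e i)"
        by (simp add: words_weak_Suc sum.union_disjoint finite_words)
      also have "(\<Sum>w\<in>(\<lambda>u. u @ [d]) ` words (\<le>) (Suc d) l. \<Prod>i\<leftarrow>w. e i) = e d * fps_nth (?H (Suc d)) l"
        by (subst sum.reindex) (auto simp: inj_on_def sum_distrib_left mult.commute)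
      finally show ?thesis using Suc by simp
    qed (simp add: words_0)
  qed
  then have step: "?H (Suc d) * (1 - fps_X * fps_const (e d)) = ?H d"
    by (simp add: algebra_simps)
  have "?H (Suc d) * (\<Prod>i<Suc d. 1 - fps_X * fps_const (e i))
      = ?H (Suc d) * (1 - fps_X * fps_const (e d)) * (\<Prod>i<d. 1 - fps_X * fps_const (e i))"
    by (simp only: prod.lessThan_Suc mult_ac)
  then show ?case by (simp only: step Suc)
qed

lemma complex_mat_triangularizable:
  fixes A :: "complex mat"
  assumes "A \<in> carrier_mat d d"
  obtains T where "T \<in> carrier_mat d d" "upper_triangular T" "similar_mat A T"
  using char_poly_factorized[OF assms] schur_decomposition_exists[OF assms] by blast

text \<open>
  The scalar is a parameter so that \<open>c = q\<close> serves the exterior and \<open>c = - q\<close> the symmetric powers. The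
  matrices that conjugate \<open>A\<close> to \<open>B\<close>, read as constant power series, conjugate the whole expression.
\<close>

lemma det_one_plus_smult_similar:
  fixes A :: "'a :: comm_ring_1 mat" and c :: "'a fps"
  assumes "similar_mat A B" "A \<in> carrier_mat d d"
  shows "det (1\<^sub>m d + c \<cdot>\<^sub>m map_mat fps_const A) = det (1\<^sub>m d + c \<cdot>\<^sub>m map_mat fps_const B)"
proof -
  interpret fps_const: comm_ring_hom "fps_const :: 'a \<Rightarrow> 'a fps"
    by unfold_locales auto
  obtain P Q where wit: "similar_mat_wit A B P Q"
    using assms(1) unfolding similar_mat_def by blast
  note w = similar_mat_witD2[OF assms(2) wit]
  let ?h = "map_mat (fps_const :: 'a \<Rightarrow> 'a fps)"
  have c: "?h B \<in> carrier_mat d d" "?h P \<in> carrier_mat d d" "?h Q \<in> carrier_mat d d" using w by auto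
  have one: "?h P * ?h Q = 1\<^sub>m d" "?h Q * ?h P = 1\<^sub>m d"
    using w by (simp_all flip: fps_const.mat_hom_mult fps_const.mat_hom_one)
  have "?h A = ?h P * ?h B * ?h Q"
    using w by (metis fps_const.mat_hom_mult mult_carrier_mat)
  moreover have "?h P * (1\<^sub>m d + c \<cdot>\<^sub>m ?h B) * ?h Q = 1\<^sub>m d + c \<cdot>\<^sub>m (?h P * ?h B * ?h Q)"
    using c one by (simp add: mult_add_distrib_mat[of _ d d _ d] add_mult_distrib_mat[of _ d d _ _ d]
      mult_smult_distrib[of _ d d _ d] mult_smult_assoc_mat[of _ d d _ d])
  ultimately have "similar_mat_wit (1\<^sub>m d + c \<cdot>\<^sub>m ?h A) (1\<^sub>m d + c \<cdot>\<^sub>m ?h B) (?h P) (?h Q)"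
    using c w one by (intro similar_mat_witI[of _ _ d]) auto
  then show ?thesis by (intro det_similar) (auto simp: similar_mat_def)
qed

lemma det_one_plus_smult_upper_triangular:
  fixes T :: "'a :: comm_ring_1 mat" and c :: "'a fps"
  assumes "T \<in> carrier_mat d d" "upper_triangular T"
  shows "det (1\<^sub>m d + c \<cdot>\<^sub>m map_mat fps_const T) = (\<Prod>i<d. 1 + c * fps_const (T $$ (i, i)))"
proof -
  let ?M = "1\<^sub>m d + c \<cdot>\<^sub>m map_mat fps_const T"
  have "upper_triangular ?M"
    using assms by (intro upper_triangularI) (auto simp: upper_triangularD)
  then have "det ?M = prod_list (diag_mat ?M)"
    using assms by (intro det_upper_triangular[of _ d]) auto
  also have "\<dots> = (\<Prod>i<d. ?M $$ (i, i))"
    using assms by (simp add: prod_list_diag_prod atLeast0LessThan)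
  finally show ?thesis using assms by simp
qed

lemma minus_q_mat:
  "1\<^sub>m d - q_mat A = 1\<^sub>m d + (- fps_X) \<cdot>\<^sub>m map_mat fps_const A" if "A \<in> carrier_mat d d"
  using that by (intro eq_matI) (auto simp: q_mat_def)

text \<open>
  Both sides are similarity invariants, so the matrix may be taken upper triangular; then the traces are
  the elementary symmetric polynomials of the diagonal entries.
\<close>

lemma mtrace_ext_power_series:
  assumes A: "A \<in> carrier_mat d d"
  shows "Abs_fps (\<lambda>m. mtrace (ext_power m A)) = det (1\<^sub>m d + q_mat A)"
proof -
  obtain T where T: "T \<in> carrier_mat d d" "upper_triangular T" and sim: "similar_mat A T"
    using complex_mat_triangularizable[OF A] .
  have "mtrace (ext_power m A) = (\<Sum>w\<in>words (<) d m. \<Prod>i\<leftarrow>w. T $$ (i, i))" for m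
    by (simp add: mtrace_ext_power_similar[OF sim] mtrace_ext_power[OF T(1)]
        minor_upper_triangular[OF T] cong: sum.cong)
  then show ?thesis
    by (simp add: elementary_symmetric_series q_mat_def det_one_plus_smult_similar[OF sim A]
        det_one_plus_smult_upper_triangular[OF T])
qed

text \<open>
  The same reduction, now with complete homogeneous symmetric polynomials. The identity is stated as a
  product to avoid dividing by the determinant.
\<close>

lemma mtrace_sym_power_series:
  assumes A: "A \<in> carrier_mat d d"
  shows "Abs_fps (\<lambda>m. mtrace (sym_power m A)) * det (1\<^sub>m d - q_mat A) = 1"
proof -
  obtain T where T: "T \<in> carrier_mat d d" "upper_triangular T" and sim: "similar_mat A T"
    using complex_mat_triangularizable[OF A] .
  have tr: "mtrace (sym_power m A) = (\<Sum>w\<in>words (\<le>) d m. \<Prod>i\<leftarrow>w. T $$ (i, i))" for m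
    by (simp add: mtrace_sym_power_similar[OF sim] mtrace_sym_power[OF T(1)]
        perm_minor_upper_triangular[OF T] cong: sum.cong)
  have "det (1\<^sub>m d - q_mat A) = (\<Prod>i<d. 1 - fps_X * fps_const (T $$ (i, i)))"
    by (simp add: minus_q_mat[OF A] det_one_plus_smult_similar[OF sim A]
        det_one_plus_smult_upper_triangular[OF T])
  then show ?thesis
    by (simp add: tr complete_symmetric_series)
qed

lemma mtrace_tensor_power:
  assumes A: "A \<in> carrier_mat d d"
  shows "tensor_power m A \<in> carrier_mat (d ^ m) (d ^ m)" "mtrace (tensor_power m A) = mtrace A ^ m"
proof (induction m)
  case (Suc m)
  {
    case 1
    then show ?case using Suc A by (auto simp: kronecker_def)
  next
    case 2
    then show ?case using Suc A by (simp add: mtrace_kronecker)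
  }
qed (auto simp: mtrace_def)

lemma mtrace_tensor_power_similar:
  fixes A B :: "'a :: comm_ring_1 mat"
  assumes AB: "similar_mat A B"
  shows "mtrace (tensor_power m A) = mtrace (tensor_power m B)"
proof -
  obtain e where "A \<in> carrier_mat e e" "B \<in> carrier_mat e e"
    using similar_matD[OF AB] by auto
  then show ?thesis using mtrace_similar[OF AB] by (simp add: mtrace_tensor_power(2))
qed

lemma mtrace_tensor_power_series:
  assumes A: "A \<in> carrier_mat d d"
  shows "Abs_fps (\<lambda>m. mtrace (tensor_power m A)) * (1 - fps_X * fps_const (mtrace A)) = 1"
proof -
  let ?T = "Abs_fps (\<lambda>m. mtrace A ^ m)"
  have "?T = 1 + fps_X * (fps_const (mtrace A) * ?T)"
  proof (rule fps_ext)
    fix m show "fps_nth ?T m = fps_nth (1 + fps_X * (fps_const (mtrace A) * ?T)) m"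
      by (cases m) simp_all
  qed
  then have "?T * (1 - fps_X * fps_const (mtrace A)) = 1" by (simp add: algebra_simps)
  then show ?thesis by (simp add: mtrace_tensor_power[OF A])
qed

lemma mtrace_pow_similar:
  fixes A B :: "'a :: comm_ring_1 mat"
  assumes "similar_mat A B"
  shows "mtrace (A ^\<^sub>m m) = mtrace (B ^\<^sub>m m)"
  using similar_mat_wit_pow[of A B] assms by (intro mtrace_similar) (meson similar_mat_def)

text \<open>
  The inverse is the geometric series \<open>\<Sum>m. A\<^sup>m q\<^sup>m\<close>. It is a two-sided inverse
  because \<open>N = 1 + q A N\<close> and \<open>N = 1 + N q A\<close>; coefficientwise, these are the two recursions
  \<open>A\<^sup>m\<^sup>+\<^sup>1 = A A\<^sup>m\<close> and \<open>A\<^sup>m\<^sup>+\<^sup>1 = A\<^sup>m A\<close>.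
\<close>

lemma mtrace_mat_inv_series:
  assumes A: "A \<in> carrier_mat d d"
  shows "mtrace (mat_inv (1\<^sub>m d - q_mat A)) = Abs_fps (\<lambda>m. mtrace (A ^\<^sub>m m))"
proof -
  let ?N = "mat d d (\<lambda>(i, j). Abs_fps (\<lambda>m. (A ^\<^sub>m m) $$ (i, j)))"
  have N: "?N \<in> carrier_mat d d" and Q: "q_mat A \<in> carrier_mat d d"
    using A by (auto simp: q_mat_def)
  have pow: "A ^\<^sub>m m \<in> carrier_mat d d" for m using A by simp
  have pow': "A ^\<^sub>m Suc m = A * A ^\<^sub>m m" for m
  proof (induction m)
    case (Suc m)
    have "A ^\<^sub>m Suc (Suc m) = (A * A ^\<^sub>m m) * A" by (metis Suc pow_mat.simps(2))
    also have "\<dots> = A * A ^\<^sub>m Suc m" using A pow[of m] by (simp add: assoc_mult_mat[of _ d d _ d _ d])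
    finally show ?case .
  qed (use A in simp)
  have left: "?N = 1\<^sub>m d + q_mat A * ?N"
  proof (intro eq_matI fps_ext)
    fix i j m assume "i < dim_row (1\<^sub>m d + q_mat A * ?N)" "j < dim_col (1\<^sub>m d + q_mat A * ?N)"
    then have ij: "i < d" "j < d" using A by (auto simp: q_mat_def)
    then have "(q_mat A * ?N) $$ (i, j)
        = fps_X * (\<Sum>c<d. fps_const (A $$ (i, c)) * Abs_fps (\<lambda>m. (A ^\<^sub>m m) $$ (c, j)))"
      using A by (simp add: q_mat_def scalar_prod_def atLeast0LessThan sum_distrib_left mult.assoc)
    then show "fps_nth (?N $$ (i, j)) m = fps_nth ((1\<^sub>m d + q_mat A * ?N) $$ (i, j)) m"
      using A pow ij Q
      by (cases m) (auto simp: pow' scalar_prod_def atLeast0LessThan fps_sum_nth simp del: pow_mat.simps(2)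
          intro!: sum.cong)
  qed (use Q in auto)
  have right: "?N = 1\<^sub>m d + ?N * q_mat A"
  proof (intro eq_matI fps_ext)
    fix i j m assume "i < dim_row (1\<^sub>m d + ?N * q_mat A)" "j < dim_col (1\<^sub>m d + ?N * q_mat A)"
    then have ij: "i < d" "j < d" using A by (auto simp: q_mat_def)
    then have "(?N * q_mat A) $$ (i, j)
        = fps_X * (\<Sum>c<d. fps_const (A $$ (c, j)) * Abs_fps (\<lambda>m. (A ^\<^sub>m m) $$ (i, c)))"
      using A by (simp add: q_mat_def scalar_prod_def atLeast0LessThan sum_distrib_left mult_ac)
    then show "fps_nth (?N $$ (i, j)) m = fps_nth ((1\<^sub>m d + ?N * q_mat A) $$ (i, j)) m"
      using A pow ij Q
      by (cases m) (auto simp: scalar_prod_def atLeast0LessThan fps_sum_nth mult.commute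
          intro!: sum.cong)
  qed (use Q in auto)
  have cancel: "(x + y) - y = x" if "x \<in> carrier_mat d d" "y \<in> carrier_mat d d"
    for x y :: "complex fps mat" using that by (intro eq_matI) auto
  have "(1\<^sub>m d - q_mat A) * ?N = ?N - q_mat A * ?N"
    using minus_mult_distrib_mat[OF _ Q N, of "1\<^sub>m d"] N by simp
  also have "\<dots> = 1\<^sub>m d"
    using cancel[of "1\<^sub>m d" "q_mat A * ?N"] left N Q by simp
  finally have l: "inverts_mat (1\<^sub>m d - q_mat A) ?N" using Q by (simp add: inverts_mat_def)
  have "?N * (1\<^sub>m d - q_mat A) = ?N - ?N * q_mat A"
    using mult_minus_distrib_mat[OF N _ Q, of "1\<^sub>m d"] N by simp
  also have "\<dots> = 1\<^sub>m d"
    using cancel[of "1\<^sub>m d" "?N * q_mat A"] right N Q by simp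
  finally have r: "inverts_mat ?N (1\<^sub>m d - q_mat A)" by (simp add: inverts_mat_def)
  have "mat_inv (1\<^sub>m d - q_mat A) = ?N"
    using Q by (intro mat_inv_eqI[OF _ l r, of d]) auto
  then show ?thesis using A pow
    by (intro fps_ext) (simp add: mtrace_def fps_sum_nth)
qed

section \<open>Class functions and representations\<close>

definition class_function :: "('g, 'b) monoid_scheme \<Rightarrow> ('g \<Rightarrow> 'a) \<Rightarrow> bool" where
  "class_function G f \<longleftrightarrow>
     (\<forall>g\<in>carrier G. \<forall>h\<in>carrier G. f (h \<otimes>\<^bsub>G\<^esub> g \<otimes>\<^bsub>G\<^esub> inv\<^bsub>G\<^esub> h) = f g)"

lemma conj_class_sym:
  assumes "group G" "x \<in> carrier G" "y \<in> conj_class G x"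
  shows "y \<in> carrier G" "x \<in> conj_class G y"
proof -
  interpret group G by fact
  obtain h where h: "h \<in> carrier G" "y = h \<otimes>\<^bsub>G\<^esub> x \<otimes>\<^bsub>G\<^esub> inv\<^bsub>G\<^esub> h"
    using assms by (auto simp: conj_class_def)
  show "y \<in> carrier G" using h assms(2) by simp
  have "x = inv\<^bsub>G\<^esub> h \<otimes>\<^bsub>G\<^esub> y \<otimes>\<^bsub>G\<^esub> inv\<^bsub>G\<^esub> (inv\<^bsub>G\<^esub> h)"
    using h assms(2) by (simp add: m_assoc) (simp add: m_assoc[symmetric])
  then show "x \<in> conj_class G y" using h(1) unfolding conj_class_def by blast
qed

lemma conj_class_trans:
  assumes "group G" "x \<in> carrier G" "y \<in> conj_class G x" "z \<in> conj_class G y"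
  shows "z \<in> conj_class G x"
proof -
  interpret group G by fact
  obtain h where h: "h \<in> carrier G" "y = h \<otimes>\<^bsub>G\<^esub> x \<otimes>\<^bsub>G\<^esub> inv\<^bsub>G\<^esub> h"
    using assms by (auto simp: conj_class_def)
  obtain k where k: "k \<in> carrier G" "z = k \<otimes>\<^bsub>G\<^esub> y \<otimes>\<^bsub>G\<^esub> inv\<^bsub>G\<^esub> k"
    using assms by (auto simp: conj_class_def)
  have "z = (k \<otimes>\<^bsub>G\<^esub> h) \<otimes>\<^bsub>G\<^esub> x \<otimes>\<^bsub>G\<^esub> inv\<^bsub>G\<^esub> (k \<otimes>\<^bsub>G\<^esub> h)"
    using h k assms(2) by (simp add: m_assoc inv_mult_group)
  then show ?thesis using h k by (auto simp: conj_class_def)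
qed

lemma conj_class_enumD:
  assumes "group G" "conj_class_enum G n C r" "p \<le> n"
  shows "C p \<in> conj_class G ` carrier G" "r p \<in> C p" "r p \<in> carrier G"
proof -
  have "C ` {0..n} = conj_class G ` carrier G"
    using assms(2) by (simp add: conj_class_enum_def bij_betw_def)
  moreover have "C p \<in> C ` {0..n}" using assms(3) by simp
  ultimately show C: "C p \<in> conj_class G ` carrier G" by simp
  show "r p \<in> C p" using assms by (simp add: conj_class_enum_def)
  with C show "r p \<in> carrier G" using conj_class_sym(1)[OF assms(1)] by blast
qed

text \<open>
  Averages over the group become weighted sums over the classes. This is where the enumeration of the
  conjugacy classes enters, and it provides the diagonal weights \<open>card (C p)\<close>.
\<close>

lemma sum_class_function:
  fixes f :: "'g \<Rightarrow> 'a :: comm_ring_1"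
  assumes G: "group G" "finite (carrier G)" and enum: "conj_class_enum G n C r"
    and f: "class_function G f"
  shows "(\<Sum>g\<in>carrier G. f g) = (\<Sum>p<Suc n. of_nat (card (C p)) * f (r p))"
proof -
  interpret group G by fact
  have self: "x \<in> conj_class G x" if "x \<in> carrier G" for x
    using that by (auto simp: conj_class_def intro!: exI[of _ "\<one>\<^bsub>G\<^esub>"])
  have class_eq: "{g \<in> carrier G. conj_class G g = conj_class G x} = conj_class G x"
    if x: "x \<in> carrier G" for x
  proof (intro equalityI subsetI)
    fix g assume "g \<in> {g \<in> carrier G. conj_class G g = conj_class G x}"
    then show "g \<in> conj_class G x" using self[of g] by simp
  next
    fix g assume g: "g \<in> conj_class G x"
    note g' = conj_class_sym[OF G(1) x g]
    have "conj_class G g = conj_class G x"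
      using conj_class_trans[OF G(1) x g] conj_class_trans[OF G(1) g'] by (intro equalityI subsetI)
    then show "g \<in> {g \<in> carrier G. conj_class G g = conj_class G x}" using g'(1) by simp
  qed
  have "(\<Sum>g\<in>carrier G. f g)
      = (\<Sum>c\<in>conj_class G ` carrier G. \<Sum>g | g \<in> carrier G \<and> conj_class G g = c. f g)"
    using G(2) by (intro sum.group[symmetric]) auto
  also have "\<dots> = (\<Sum>c\<in>conj_class G ` carrier G. \<Sum>g\<in>c. f g)"
  proof (rule sum.cong[OF refl])
    fix c assume "c \<in> conj_class G ` carrier G"
    then obtain x where "x \<in> carrier G" "c = conj_class G x" by blast
    then show "(\<Sum>g | g \<in> carrier G \<and> conj_class G g = c. f g) = (\<Sum>g\<in>c. f g)"
      by (simp only: class_eq)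
  qed
  also have "\<dots> = (\<Sum>p\<in>{0..n}. \<Sum>g\<in>C p. f g)"
    using enum by (intro sum.reindex_bij_betw[symmetric]) (simp add: conj_class_enum_def)
  also have "\<dots> = (\<Sum>p\<in>{0..n}. of_nat (card (C p)) * f (r p))"
  proof (intro sum.cong refl)
    fix p assume p: "p \<in> {0..n}"
    then have "C p \<in> conj_class G ` carrier G" "r p \<in> C p"
      using conj_class_enumD[OF G(1) enum] by simp_all
    then obtain x where x: "x \<in> carrier G" "C p = conj_class G x" by blast
    have "f y = f x" if "y \<in> C p" for y
      using that x f by (auto simp: conj_class_def class_function_def)
    then have "f y = f (r p)" if "y \<in> C p" for y using that \<open>r p \<in> C p\<close> by simp
    then have "(\<Sum>g\<in>C p. f g) = (\<Sum>g\<in>C p. f (r p))" by (intro sum.cong) auto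
    then show "(\<Sum>g\<in>C p. f g) = of_nat (card (C p)) * f (r p)" by simp
  qed
  finally show ?thesis by (simp add: atLeast0AtMost lessThan_Suc_atMost)
qed

lemma representation_carrier:
  assumes "representation G d \<rho>" "g \<in> carrier G"
  shows "\<rho> g \<in> carrier_mat d d"
  using assms by (auto simp: representation_def hom_def intro!: carrier_GL)

text \<open>
  Conjugate group elements act by similar matrices, so every similarity invariant of \<open>\<rho> g\<close> is a class
  function of \<open>g\<close>.
\<close>

lemma representation_similar:
  assumes G: "group G" and \<rho>: "representation G d \<rho>" and gh: "g \<in> carrier G" "h \<in> carrier G"
  shows "similar_mat (\<rho> (h \<otimes>\<^bsub>G\<^esub> g \<otimes>\<^bsub>G\<^esub> inv\<^bsub>G\<^esub> h)) (\<rho> g)"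
proof -
  interpret G: group G by fact
  interpret M: ring "ring_mat TYPE(complex) d ()" by (rule ring_mat)
  have GL: "group (GL d)" unfolding GL_def by (rule M.units_group)
  have hom: "group_hom G (GL d) \<rho>"
    using G GL \<rho> by (simp add: group_hom_def group_hom_axioms_def representation_def)
  have mult: "\<rho> (x \<otimes>\<^bsub>G\<^esub> y) = \<rho> x * \<rho> y" if "x \<in> carrier G" "y \<in> carrier G" for x y
    using group_hom.hom_mult[OF hom that] by (simp add: GL_def units_of_def ring_mat_def)
  have one: "\<rho> \<one>\<^bsub>G\<^esub> = 1\<^sub>m d"
    using group_hom.hom_one[OF hom] by (simp add: GL_def units_of_def ring_mat_def)
  have inv: "\<rho> h * \<rho> (inv\<^bsub>G\<^esub> h) = 1\<^sub>m d" "\<rho> (inv\<^bsub>G\<^esub> h) * \<rho> h = 1\<^sub>m d"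
    using gh by (simp_all only: mult[symmetric] G.inv_closed G.r_inv G.l_inv one)
  show ?thesis
    by (rule similar_matI[of _ _ "\<rho> h" "\<rho> (inv\<^bsub>G\<^esub> h)" d])
       (use gh inv in \<open>auto simp: mult intro!: representation_carrier[OF \<rho>] mult_carrier_mat[of _ d d]\<close>)
qed

lemma class_function_similar:
  assumes "group G" "representation G d \<rho>"
    and "\<And>A B. similar_mat A B \<Longrightarrow> F A = F B"
  shows "class_function G (\<lambda>g. F (\<rho> g))"
  unfolding class_function_def
  by (intro ballI assms(3) representation_similar[OF assms(1,2)])

lemma class_function_character:
  assumes "group G" "representation G d \<rho>"
  shows "class_function G (character \<rho>)"
  unfolding character_def[abs_def] by (rule class_function_similar[OF assms]) (rule mtrace_similar)

section \<open>Clebsch--Gordan matrices and their minors\<close>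

text \<open>
  The trace is multiplicative on Kronecker products of arbitrary square matrices. In this generality the
  lemma applies directly to the matrices of the tensor, exterior and symmetric powers.
\<close>

lemma cg_matrix_eq_virtual_square:
  assumes "\<And>g. g \<in> carrier G \<Longrightarrow> square_mat (\<rho> g)"
    and "\<And>i. i \<le> n \<Longrightarrow> representation G (ds i) (S i)"
  shows "cg_matrix G n S \<rho> = cg_matrix_virtual G n S (character \<rho>)"
proof -
  have "character (tensor_rep \<rho> (S i)) g = character \<rho> g * character (S i) g"
    if "i \<le> n" "g \<in> carrier G" for i g
  proof -
    have "\<rho> g \<in> carrier_mat (dim_row (\<rho> g)) (dim_row (\<rho> g))"
      by (rule carrier_matI) (use assms(1)[OF that(2)] in auto)
    from mtrace_kronecker[OF this representation_carrier[OF assms(2)[OF that(1)] that(2)]]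
    show ?thesis by (simp only: character_def tensor_rep_def)
  qed
  then show ?thesis
    unfolding cg_matrix_def cg_matrix_virtual_def scalar_product_def
    by (intro cong_mat) (auto intro!: sum.cong arg_cong2[where f = "(*)"])
qed

text \<open>
  In matrix form: \<open>M = \<chi> D \<chi>\<^sup>*\<close> with \<open>D\<close> diagonal and \<open>\<chi>\<^sup>*\<close> the conjugate transpose of the character table.
\<close>

lemma cg_matrix_virtual_entry:
  assumes G: "group G" "finite (carrier G)" and enum: "conj_class_enum G n C r"
    and S: "\<And>i. i \<le> n \<Longrightarrow> representation G (ds i) (S i)"
    and \<phi>: "class_function G \<phi>" and ij: "i \<le> n" "j \<le> n"
  shows "cg_matrix_virtual G n S \<phi> $$ (i, j) = (\<Sum>p<Suc n. character (S i) (r p) *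
      (1 / of_nat (card (carrier G)) * (of_nat (card (C p)) * \<phi> (r p))) * cnj (character (S j) (r p)))"
proof -
  have "class_function G (\<lambda>g. \<phi> g * character (S i) g * cnj (character (S j) g))"
    using \<phi> class_function_character[OF G(1) S[OF ij(1)]] class_function_character[OF G(1) S[OF ij(2)]]
    by (simp add: class_function_def)
  note sum = sum_class_function[OF G enum this]
  have "cg_matrix_virtual G n S \<phi> $$ (i, j) = 1 / of_nat (card (carrier G)) *
      (\<Sum>g\<in>carrier G. \<phi> g * character (S i) g * cnj (character (S j) g))"
    using ij by (simp add: cg_matrix_virtual_def scalar_product_def)
  then show ?thesis
    unfolding sum sum_distrib_left by (simp only: mult_ac)
qed

text \<open>
  The minor formula over an arbitrary coefficient ring. The ring homomorphism \<open>\<iota>\<close> embeds the constants; it is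
  \<open>fps_const\<close> for the power series in \<open>q\<close> and \<open>mconst\<close> for the series in the variables of \<open>X\<close>.
\<close>

lemma minor_class_weights:
  fixes \<iota> :: "complex \<Rightarrow> 'a :: comm_ring_1"
  assumes \<iota>: "comm_ring_hom \<iota>"
    and v: "v \<in> increasing_seqs k n" and w: "w \<in> increasing_seqs k n"
    and N: "N \<in> carrier_mat (Suc n) (Suc n)"
    and entry: "\<And>i j. i \<le> n \<Longrightarrow> j \<le> n \<Longrightarrow> N $$ (i, j) = (\<Sum>p<Suc n. \<iota> (character (S i) (r p)) *
        (\<iota> c * F p) * \<iota> (cnj (character (S j) (r p))))"
  shows "minor N v w = \<iota> (c ^ k) * (\<Sum>ps\<in>increasing_seqs k n.
      \<iota> (minor (character_table n S r) v ps * cnj (minor (character_table n S r) w ps)) *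
      (\<Prod>m<k. F (ps ! m)))"
proof -
  interpret \<iota>: comm_ring_hom \<iota> by fact
  let ?X = "character_table n S r"
  let ?A = "map_mat \<iota> ?X" and ?B = "map_mat \<iota> (map_mat cnj ?X)"
  have cnj: "comm_ring_hom cnj" by unfold_locales auto
  have X: "?X \<in> carrier_mat (Suc n) (Suc n)" by (simp add: character_table_def)
  note v' = v[unfolded increasing_seqs_eq_words] and w' = w[unfolded increasing_seqs_eq_words]
  have "N = mat (Suc n) (Suc n) (\<lambda>(i, j). \<Sum>p<Suc n. ?A $$ (i, p) * (\<iota> c * F p) * ?B $$ (j, p))"
    using N by (intro eq_matI) (auto simp: entry character_table_def simp del: sum.lessThan_Suc)
  then have "minor N v w = (\<Sum>x\<in>words (<) (Suc n) k.
      minor ?A v x * minor ?B w x * (\<Prod>l<k. \<iota> c * F (x ! l)))"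
    using minor_weighted_gram[OF _ _ v' w', of ?A ?B "\<lambda>p. \<iota> c * F p"] X by simp
  also have "\<dots> = (\<Sum>x\<in>words (<) (Suc n) k. \<iota> (c ^ k) *
      (\<iota> (minor ?X v x * cnj (minor ?X w x)) * (\<Prod>l<k. F (x ! l))))"
  proof (intro sum.cong refl)
    fix x assume x: "x \<in> words (<) (Suc n) k"
    have "minor ?A v x = \<iota> (minor ?X v x)"
      by (rule minor_map_mat[OF \<iota> X v' x])
    moreover have "minor ?B w x = \<iota> (cnj (minor ?X w x))"
      using minor_map_mat[OF \<iota> _ w' x, of "map_mat cnj ?X"] minor_map_mat[OF cnj X w' x] X by simp
    ultimately show "minor ?A v x * minor ?B w x * (\<Prod>l<k. \<iota> c * F (x ! l))
        = \<iota> (c ^ k) * (\<iota> (minor ?X v x * cnj (minor ?X w x)) * (\<Prod>l<k. F (x ! l)))"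
      by (simp add: prod.distrib \<iota>.hom_mult \<iota>.hom_power mult_ac)
  qed
  finally show ?thesis by (simp add: increasing_seqs_eq_words sum_distrib_left)
qed

lemma comm_ring_hom_fps_const: "comm_ring_hom (fps_const :: 'a :: comm_ring_1 \<Rightarrow> 'a fps)"
  by unfold_locales auto

lemma minor_series:
  assumes G: "group G" "finite (carrier G)" and enum: "conj_class_enum G n C r"
    and S: "\<And>i. i \<le> n \<Longrightarrow> representation G (ds i) (S i)"
    and \<phi>: "\<And>m. class_function G (\<phi> m)"
    and v: "v \<in> increasing_seqs k n" and w: "w \<in> increasing_seqs k n"
  shows "minor (matrix_series n (\<lambda>m. cg_matrix_virtual G n S (\<phi> m))) v w =
    fps_const (1 / of_nat (card (carrier G)) ^ k) * (\<Sum>ps\<in>increasing_seqs k n.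
      fps_const (minor (character_table n S r) v ps * cnj (minor (character_table n S r) w ps)) *
      (\<Prod>m<k. of_nat (card (C (ps ! m))) * Abs_fps (\<lambda>l. \<phi> l (r (ps ! m)))))"
proof -
  let ?c = "1 / of_nat (card (carrier G)) :: complex"
  have entry: "matrix_series n (\<lambda>m. cg_matrix_virtual G n S (\<phi> m)) $$ (i, j)
      = (\<Sum>p<Suc n. fps_const (character (S i) (r p)) *
          (fps_const ?c * (of_nat (card (C p)) * Abs_fps (\<lambda>l. \<phi> l (r p)))) *
          fps_const (cnj (character (S j) (r p))))" if "i \<le> n" "j \<le> n" for i j
    using that by (intro fps_ext) (simp add: matrix_series_def fps_sum_nth fps_of_nat[symmetric]
        cg_matrix_virtual_entry[OF G enum S \<phi>] del: sum.lessThan_Suc fps_const_mult)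
  show ?thesis
    using minor_class_weights[OF comm_ring_hom_fps_const v w _ entry]
    by (simp add: matrix_series_def power_one_over)
qed

lemma mcoeff_mconst_mult:
  fixes f :: "('x, 'a :: comm_ring_1) mfps"
  shows "mcoeff (mconst c * f) m = c * mcoeff f m"
proof -
  have "mcoeff (mconst c * f) m = (\<Sum>a | a \<subseteq># m. if a = {#} then c * mcoeff f (m - a) else 0)"
    unfolding times_mfps_def mconst_def mcoeff_Abs by (intro sum.cong) auto
  then show ?thesis by (simp add: finite_submultisets)
qed

lemma mcoeff_sum:
  fixes F :: "'i \<Rightarrow> ('x, 'a :: comm_ring_1) mfps"
  shows "mcoeff (\<Sum>p\<in>P. F p) m = (\<Sum>p\<in>P. mcoeff (F p) m)"
  by (induction P rule: infinite_finite_induct) (auto simp: zero_mfps_def plus_mfps_def)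

lemma comm_ring_hom_mconst: "comm_ring_hom (mconst :: 'a :: comm_ring_1 \<Rightarrow> ('x, 'a) mfps)"
proof
  fix a b :: 'a
  show "mconst (a * b) = (mconst a * mconst b :: ('x, 'a) mfps)"
    by (rule mfps_eqI) (simp add: mcoeff_mconst_mult, simp add: mconst_def)
qed (auto intro!: mfps_eqI simp: mconst_def plus_mfps_def zero_mfps_def one_mfps_def)

text \<open>
  Linearity has to be checked on coefficients, because \<open>X\<close> may be infinite and the linear form is then no
  finite sum in the ring.
\<close>

lemma linear_form_sum:
  fixes a :: "'i \<Rightarrow> 'a :: comm_ring_1"
  shows "linear_form X (\<lambda>x. \<Sum>p\<in>P. a p * f p x) = (\<Sum>p\<in>P. mconst (a p) * linear_form X (f p))"
  by (rule mfps_eqI)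
     (simp add: mcoeff_sum mcoeff_mconst_mult linear_form_def sum_distrib_left sum.swap[of _ P])

lemma linear_form_cong:
  "(\<And>x. x \<in> X \<Longrightarrow> f x = g x) \<Longrightarrow> linear_form X f = linear_form X g"
  by (auto simp: linear_form_def intro!: arg_cong[where f = Abs_mfps] ext sum.cong)

lemma minor_formal:
  fixes X :: "'x set"
  assumes G: "group G" "finite (carrier G)" and enum: "conj_class_enum G n C r"
    and S: "\<And>i. i \<le> n \<Longrightarrow> representation G (ds i) (S i)"
    and Rx: "\<And>x. x \<in> X \<Longrightarrow> \<exists>e. representation G e (Rx x)"
    and v: "v \<in> increasing_seqs k n" and w: "w \<in> increasing_seqs k n"
  shows "minor (cg_matrix_formal G n S X Rx) v w =
    mconst (1 / of_nat (card (carrier G)) ^ k) * (\<Sum>ps\<in>increasing_seqs k n.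
      mconst (minor (character_table n S r) v ps * cnj (minor (character_table n S r) w ps)) *
      (\<Prod>m<k. mconst (of_nat (card (C (ps ! m)))) * formal_character X Rx (r (ps ! m))))"
proof -
  interpret mconst: comm_ring_hom "mconst :: complex \<Rightarrow> ('x, complex) mfps"
    by (rule comm_ring_hom_mconst)
  let ?c = "1 / of_nat (card (carrier G)) :: complex"
  have entry: "cg_matrix_formal G n S X Rx $$ (i, j)
      = (\<Sum>p<Suc n. mconst (character (S i) (r p)) *
          (mconst ?c * (mconst (of_nat (card (C p))) * formal_character X Rx (r p))) *
          mconst (cnj (character (S j) (r p))))" if ij: "i \<le> n" "j \<le> n" for i j
  proof -
    let ?a = "\<lambda>p. character (S i) (r p) * ?c * of_nat (card (C p)) * cnj (character (S j) (r p))"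
    have "cg_matrix G n S (Rx x) $$ (i, j) = (\<Sum>p<Suc n. ?a p * character (Rx x) (r p))"
      if x: "x \<in> X" for x
    proof -
      obtain e where e: "representation G e (Rx x)" using Rx[OF x] by blast
      show ?thesis
        using cg_matrix_virtual_entry[OF G enum S class_function_character[OF G(1) e] ij]
          cg_matrix_eq_virtual[OF e S]
        by (simp add: mult_ac del: sum.lessThan_Suc)
    qed
    then have "cg_matrix_formal G n S X Rx $$ (i, j)
        = linear_form X (\<lambda>x. \<Sum>p<Suc n. ?a p * character (Rx x) (r p))"
      using ij by (simp add: cg_matrix_formal_def cong: linear_form_cong del: sum.lessThan_Suc)
    then show ?thesis
      unfolding linear_form_sum formal_character_def mconst.hom_mult by (simp only: mult_ac)
  qed
  show ?thesis
    using minor_class_weights[OF comm_ring_hom_mconst v w _ entry]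
    by (simp add: cg_matrix_formal_def power_one_over)
qed

lemma fps_divide_eq_mult:
  fixes a :: "'a :: field fps"
  assumes "h * b = 1"
  shows "a / b = a * h"
proof -
  have "b \<noteq> 0" using assms by auto
  then have "a * h * b / b = a * h" by simp
  then show ?thesis using assms by (simp add: mult.assoc)
qed

section \<open>The minors of the five Clebsch--Gordan matrices\<close>

theorem mainTheorem1:
  fixes G :: "('g, 'b) monoid_scheme"
    and n d k :: nat
    and ds :: "nat \<Rightarrow> nat"
    and S :: "nat \<Rightarrow> 'g \<Rightarrow> complex mat"
    and C :: "nat \<Rightarrow> 'g set"
    and r :: "nat \<Rightarrow> 'g"
    and R :: "'g \<Rightarrow> complex mat"
    and X :: "'x set"
    and Rx :: "'x \<Rightarrow> 'g \<Rightarrow> complex mat"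
    and "is" js :: "nat list"
  assumes "group G" and "finite (carrier G)"
    and "irreducibles G n ds S"
    and "conj_class_enum G n C r"
    and "representation G d R" and "faithful G R"
    and "\<forall>x\<in>X. \<exists>e. representation G e (Rx x)"
    and "1 \<le> k" and "k \<le> n + 1"
    and "is \<in> increasing_seqs k n" and "js \<in> increasing_seqs k n"
  shows
    "(minor (cg_matrix_formal G n S X Rx) is js =
       mconst (1 / of_nat (card (carrier G)) ^ k) *
       (\<Sum>ps\<in>increasing_seqs k n. mconst (minor (character_table n S r) is ps * cnj (minor (character_table n S r) js ps)) *
         (\<Prod>m<k. mconst (of_nat (card (C (ps ! m)))) * formal_character X Rx (r (ps ! m))))) \<and>
    (minor (cg_ext G n S R) is js =
       fps_const (1 / of_nat (card (carrier G)) ^ k) *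
       (\<Sum>ps\<in>increasing_seqs k n. fps_const (minor (character_table n S r) is ps * cnj (minor (character_table n S r) js ps)) *
         (\<Prod>m<k. of_nat (card (C (ps ! m))) * det (1\<^sub>m d + q_mat (R (r (ps ! m))))))) \<and>
    (minor (cg_sym G n S R) is js =
       fps_const (1 / of_nat (card (carrier G)) ^ k) *
       (\<Sum>ps\<in>increasing_seqs k n. fps_const (minor (character_table n S r) is ps * cnj (minor (character_table n S r) js ps)) *
         (\<Prod>m<k. of_nat (card (C (ps ! m))) / det (1\<^sub>m d - q_mat (R (r (ps ! m))))))) \<and>
    (minor (cg_tensor G n S R) is js =
       fps_const (1 / of_nat (card (carrier G)) ^ k) *
       (\<Sum>ps\<in>increasing_seqs k n. fps_const (minor (character_table n S r) is ps * cnj (minor (character_table n S r) js ps)) *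
         (\<Prod>m<k. of_nat (card (C (ps ! m))) /
                   (1 - fps_X * fps_const (mtrace (R (r (ps ! m)))))))) \<and>
    (minor (cg_adams G n S R) is js =
       fps_const (1 / of_nat (card (carrier G)) ^ k) *
       (\<Sum>ps\<in>increasing_seqs k n. fps_const (minor (character_table n S r) is ps * cnj (minor (character_table n S r) js ps)) *
         (\<Prod>m<k. of_nat (card (C (ps ! m))) *
                   mtrace (mat_inv (1\<^sub>m d - q_mat (R (r (ps ! m))))))))"
proof -
  have G: "group G" "finite (carrier G)" and enum: "conj_class_enum G n C r"
    and R: "representation G d R" and iss: "is \<in> increasing_seqs k n" and js: "js \<in> increasing_seqs k n"
    using assms by auto
  have S: "representation G (ds i) (S i)" if "i \<le> n" for i
    using assms(3) that by (simp add: irreducibles_def irreducible_rep_def)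
  have rR: "R (r (ps ! m)) \<in> carrier_mat d d" if "ps \<in> increasing_seqs k n" "m < k" for ps m
  proof -
    have "ps ! m \<in> {0..n}" using that nth_mem by (fastforce simp: increasing_seqs_def)
    then have "r (ps ! m) \<in> carrier G"
      using conj_class_enumD[OF G(1) enum] by simp
    then show ?thesis using R by (rule representation_carrier[rotated])
  qed
  \<comment> \<open>The exterior, symmetric and tensor powers share one argument: each is an operation \<open>P m\<close> on
    square matrices whose trace depends on the similarity class only.\<close>
  have powers: "minor (matrix_series n (\<lambda>m. cg_matrix G n S (\<lambda>g. P m (R g)))) is js =
      fps_const (1 / of_nat (card (carrier G)) ^ k) * (\<Sum>ps\<in>increasing_seqs k n.
        fps_const (minor (character_table n S r) is ps * cnj (minor (character_table n S r) js ps)) *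
        (\<Prod>m<k. of_nat (card (C (ps ! m))) * Abs_fps (\<lambda>l. mtrace (P l (R (r (ps ! m)))))))"
    if sq: "\<And>m A. A \<in> carrier_mat d d \<Longrightarrow> square_mat (P m A)"
      and sim: "\<And>m A B. similar_mat A B \<Longrightarrow> mtrace (P m A) = mtrace (P m B)"
    for P :: "nat \<Rightarrow> complex mat \<Rightarrow> complex mat"
  proof -
    have "cg_matrix G n S (\<lambda>g. P m (R g)) = cg_matrix_virtual G n S (\<lambda>g. mtrace (P m (R g)))" for m
      using cg_matrix_eq_virtual_square[of G "\<lambda>g. P m (R g)" n ds S] sq representation_carrier[OF R] S
      by (simp add: character_def[abs_def])
    moreover have "class_function G (\<lambda>g. mtrace (P m (R g)))" for m
      by (rule class_function_similar[OF G(1) R]) (rule sim)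
    ultimately show ?thesis
      using minor_series[OF G enum S _ iss js, where \<phi> = "\<lambda>m g. mtrace (P m (R g))"] by simp
  qed
  have adams: "class_function G (adams m R)" for m
    unfolding adams_def[abs_def] by (rule class_function_similar[OF G(1) R]) (rule mtrace_pow_similar)
  show ?thesis
  proof (intro conjI)
    show "minor (cg_matrix_formal G n S X Rx) is js =
       mconst (1 / of_nat (card (carrier G)) ^ k) *
       (\<Sum>ps\<in>increasing_seqs k n. mconst (minor (character_table n S r) is ps * cnj (minor (character_table n S r) js ps)) *
         (\<Prod>m<k. mconst (of_nat (card (C (ps ! m)))) * formal_character X Rx (r (ps ! m))))"
      using assms(7) by (intro minor_formal[OF G enum S _ iss js]) auto
  next
    show "minor (cg_ext G n S R) is js = fps_const (1 / of_nat (card (carrier G)) ^ k) *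
       (\<Sum>ps\<in>increasing_seqs k n. fps_const (minor (character_table n S r) is ps * cnj (minor (character_table n S r) js ps)) *
         (\<Prod>m<k. of_nat (card (C (ps ! m))) * det (1\<^sub>m d + q_mat (R (r (ps ! m))))))"
      unfolding cg_ext_def
      by (subst powers[of ext_power], rule square_ext_power, erule mtrace_ext_power_similar)
        (intro refl sum.cong prod.cong arg_cong2[where f = "(*)"],
          simp add: mtrace_ext_power_series[OF rR])
  next
    show "minor (cg_sym G n S R) is js = fps_const (1 / of_nat (card (carrier G)) ^ k) *
       (\<Sum>ps\<in>increasing_seqs k n. fps_const (minor (character_table n S r) is ps * cnj (minor (character_table n S r) js ps)) *
         (\<Prod>m<k. of_nat (card (C (ps ! m))) / det (1\<^sub>m d - q_mat (R (r (ps ! m))))))"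
      unfolding cg_sym_def
      by (subst powers[of sym_power], rule square_sym_power, erule mtrace_sym_power_similar)
        (intro refl sum.cong prod.cong arg_cong2[where f = "(*)"],
          simp add: fps_divide_eq_mult[OF mtrace_sym_power_series[OF rR]])
  next
    have sq: "square_mat (tensor_power m A)" if "A \<in> carrier_mat d d" for m and A :: "complex mat"
      using mtrace_tensor_power(1)[OF that, of m] by auto
    show "minor (cg_tensor G n S R) is js = fps_const (1 / of_nat (card (carrier G)) ^ k) *
       (\<Sum>ps\<in>increasing_seqs k n. fps_const (minor (character_table n S r) is ps * cnj (minor (character_table n S r) js ps)) *
         (\<Prod>m<k. of_nat (card (C (ps ! m))) / (1 - fps_X * fps_const (mtrace (R (r (ps ! m)))))))"
      unfolding cg_tensor_def
      by (subst powers[of tensor_power], erule sq, erule mtrace_tensor_power_similar)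
        (intro refl sum.cong prod.cong arg_cong2[where f = "(*)"],
          simp add: fps_divide_eq_mult[OF mtrace_tensor_power_series[OF rR]])
  next
    show "minor (cg_adams G n S R) is js = fps_const (1 / of_nat (card (carrier G)) ^ k) *
       (\<Sum>ps\<in>increasing_seqs k n. fps_const (minor (character_table n S r) is ps * cnj (minor (character_table n S r) js ps)) *
         (\<Prod>m<k. of_nat (card (C (ps ! m))) * mtrace (mat_inv (1\<^sub>m d - q_mat (R (r (ps ! m)))))))"
      unfolding cg_adams_def
      by (subst minor_series[OF G enum _ adams iss js], erule S)
        (intro refl sum.cong prod.cong arg_cong2[where f = "(*)"],
          simp add: adams_def mtrace_mat_inv_series[OF rR])
  qed
qed

end
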